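(* The numbers $(d(n))_{n=0}^\infty$ satisfy the recurrence relation $$d(n)=v(n)-\sum_{k=1}^{n-1} r(n,k)\,d(k)\qquad (n\ge 1),$$ where $(r(n,k))_{1\le k\le n}$ is a triangular array of integers defined by $$r(n,k)=2^{n-k}\,\frac{(2n)!}{(2k)!}\,[t^{n-k}]\,U(t)^{2k}\qquad(1\le k\le n).$$ (In particular, every $r(n,k)$ is an integer.)
   Context: Here $[t^j]f(t)$ denotes the coefficient of $t^j$ in the power series $f(t)$ around $t=0$. The Gauss hypergeometric function is ${}_2F_1(a,b;c;z)=\sum_{n=0}^\infty \frac{1}{n!}\frac{(a)_n(b)_n}{(c)_n}z^n$ with $(x)_n=x(x+1)\cdots(x+n-1)$. Define, as power series around $t=0$, $$U(t)=\frac{{}_2F_1(\tfrac34,\tfrac34;\tfrac32;4t)}{{}_2F_1(\tfrac14,\tfrac14;\tfrac12;4t)},\qquad V(t)=\sqrt{{}_2F_1(\tfrac14,\tfrac14;\tfrac12;4t)}\quad (V(0)=1),$$ and define the numbers $v(n)$ by $V(t)=\sum_{n=0}^\infty\frac{v(n)}{2^n(2n)!}t^n$. The sequence $(d(n))_{n=0}^\infty$ is defined as follows. Let $\theta_3(x)=\sum_{n=-\infty}^\infty e^{-\pi n^2 x}$ for $\operatorname{Re}(x)>0$, and let $\sigma_3(z)=\frac{1}{\sqrt{1+z}}\,\theta_3\!\left(\frac{1-z}{1+z}\right)$ for $|z|<1$ (principal square root); $\sigma_3$ is an even function. Let $\Phi=\frac{\Gamma(1/4)^8}{128\pi^4}$.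 The real numbers $d(n)$ are defined by the Taylor expansion $$\sigma_3(z)=\theta_3(1)\sum_{n=0}^\infty\frac{d(n)}{(2n)!}\Phi^n z^{2n}\qquad(|z|<1).$$ *)

theory Defs
  imports
    "HOL-Complex_Analysis.Complex_Analysis"
    "HOL-Computational_Algebra.Computational_Algebra"
begin

(* The third argument of fps_hypergeo scales the variable, so "fps_hypergeo [a, b] [c] 4"
   is the expansion of 2F1(a, b; c; 4t) in powers of t. *)

definition U :: "real fps" where
  "U = fps_hypergeo [3/4, 3/4] [3/2] 4 / fps_hypergeo [1/4, 1/4] [1/2] 4"

definition V :: "real fps" where
  "V = fps_radical root 2 (fps_hypergeo [1/4, 1/4] [1/2] 4)"

lemma V_nth_0: "V $ 0 = 1"
  by (simp add: V_def del: fps_hypergeo_nth)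

lemma V_square: "V ^ 2 = fps_hypergeo [1/4, 1/4] [1/2] 4"
  using power_radical[of "fps_hypergeo [1/4, 1/4] [1/2] (4::real)" root 1]
  by (simp add: V_def numeral_2_eq_2 del: fps_hypergeo_nth)

definition v :: "nat \<Rightarrow> real" where
  "v n = 2 ^ n * fact (2 * n) * V $ n"

(* Real-valued: that the entries are integers is part of the theorem. *)
definition r :: "nat \<Rightarrow> nat \<Rightarrow> real" where
  "r n k = 2 ^ (n - k) * (fact (2 * n) / fact (2 * k)) * (U ^ (2 * k)) $ (n - k)"

definition theta3 :: "complex \<Rightarrow> complex" where
  "theta3 x = (\<Sum>\<^sub>\<infinity>n::int. exp (- of_real pi * of_int n ^ 2 * x))"

definition sigma3 :: "complex \<Rightarrow> complex" where
  "sigma3 z = 1 / csqrt (1 + z) * theta3 ((1 - z) / (1 + z))"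

definition Phi :: real where
  "Phi = Gamma (1/4) ^ 8 / (128 * pi ^ 4)"

(* Since theta3 1 and Phi are nonzero, at most one sequence satisfies this. *)
definition taylor_sigma3 :: "(nat \<Rightarrow> real) \<Rightarrow> bool" where
  "taylor_sigma3 d \<longleftrightarrow>
     (\<forall>z::complex. norm z < 1 \<longrightarrow>
       ((\<lambda>n. theta3 1 * (of_real (d n / fact (2 * n) * Phi ^ n) * z ^ (2 * n))) sums sigma3 z))"

end

theory Submission
  imports Defs "HOL-Probability.Distributions"
begin

text \<open>
  Put \<open>a = \<theta>\<^sub>3\<^sup>2\<close>, \<open>b = \<theta>\<^sub>4\<^sup>2\<close>, \<open>c = \<theta>\<^sub>2\<^sup>2\<close> as functions of the nome. Everything about them is
  extracted from the doubling relations \<open>2 a(q\<^sup>2) = a(q) + b(q)\<close>, \<open>b(q\<^sup>2)\<^sup>2 = a(q) b(q)\<close>: they force a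
  closed system of differential equations, because a defect \<open>F\<close> of one of these equations satisfies a
  relation between \<open>F(q\<^sup>2)\<close> and \<open>F(q)\<close> that is impossible for a nonzero power series. Hence \<open>a\<close> and \<open>x a\<close>, as functions of
  \<open>s = \<lambda> - 1/2\<close> with \<open>\<lambda> = c\<^sup>2 / a\<^sup>2\<close>, solve the differential equation of the complete elliptic integrals, whose even and odd
  solutions are \<open>E(s) = 2F1(1/4, 1/4; 1/2; 4s\<^sup>2)\<close> and \<open>O(s) = s 2F1(3/4, 3/4; 3/2; 4s\<^sup>2)\<close>. The
  coefficients of the combinations are read off at both ends \<open>x \<rightarrow> 0, \<infinity>\<close>, using \<open>x a \<rightarrow> 1\<close> as \<open>x \<rightarrow> 0\<close> (a Gaussian
  integral) and the logarithmic singularities of \<open>E\<close> and \<open>O\<close>; the modular transformation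
  \<open>x \<mapsto> 1/x\<close> is not needed. The result is \<open>(1 + x) a = 2 a(1) E\<close> and
  \<open>(1 - x) a = 2 a(1) O / sqrt (2 \<Phi>)\<close>, where \<open>a(1)\<close> is the value at \<open>x = 1\<close>. With
  \<open>z = (1 - x) / (1 + x)\<close> this says \<open>\<sigma>\<^sub>3(z)\<^sup>2 = \<theta>\<^sub>3(1)\<^sup>2 E\<close> and \<open>\<Phi> z\<^sup>2 = t U(t)\<^sup>2 / 2\<close> with \<open>t = s\<^sup>2\<close>, so that
  \<open>V(t)\<close> is the composition of \<open>\<Sum>n. d(n) w\<^sup>n / (2n)!\<close> with \<open>w = t U(t)\<^sup>2 / 2\<close>, and comparing
  coefficients gives the recurrence. Integrality holds because \<open>\<Sum>k. 2\<^sup>k u\<^sub>k y\<^bsup>2k+1\<^esup>\<close>, where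
  \<open>U(t) = \<Sum>k. u\<^sub>k t\<^sup>k\<close>, is a quotient of exponential generating functions of integer sequences.
\<close>

unbundle no vec_syntax

section \<open>Integrality\<close>

text \<open>These are the exponential generating functions of integer sequences, also called Hurwitz
  series.\<close>

definition hurwitz :: "real fps \<Rightarrow> bool" where
  "hurwitz F \<longleftrightarrow> (\<forall>n. fact n * F $ n \<in> \<int>)"

lemma fact_mult_fps_mult_nth:
  fixes F G :: "real fps"
  shows "fact n * (F * G) $ n =
    (\<Sum>i=0..n. of_nat (n choose i) * (fact i * F $ i) * (fact (n - i) * G $ (n - i)))"
  unfolding fps_mult_nth sum_distrib_left
  by (intro sum.cong refl) (simp add: binomial_fact)

lemma hurwitz_mult: "hurwitz F \<Longrightarrow> hurwitz G \<Longrightarrow> hurwitz (F * G)"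
  unfolding hurwitz_def fact_mult_fps_mult_nth 
  by (intro allI Ints_sum Ints_mult[OF Ints_mult[OF Ints_of_nat]]) auto

text \<open>In the binomial convolution for \<open>F * G\<close> the term with \<open>i = n\<close>
  is \<open>fact n * F $ n\<close> itself, because \<open>G $ 0 = 1\<close>; all other terms are
  integers by induction.\<close>

lemma hurwitz_cancel_right:
  assumes "hurwitz (F * G)" "hurwitz G" "G $ 0 = 1"
  shows "hurwitz F"
  unfolding hurwitz_def
proof
  fix n show "fact n * F $ n \<in> \<int>"
  proof (induction n rule: less_induct)
    case (less n)
    have "fact n * (F * G) $ n = fact n * F $ n +
      (\<Sum>i<n. of_nat (n choose i) * (fact i * F $ i) * (fact (n - i) * G $ (n - i)))"
      unfolding fact_mult_fps_mult_nth atLeast0AtMost lessThan_Suc_atMost[symmetric]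
      using assms(3) by simp
    moreover have "(\<Sum>i<n. of_nat (n choose i) * (fact i * F $ i) * (fact (n - i) * G $ (n - i))) \<in> \<int>"
      using assms(2) unfolding hurwitz_def by (intro Ints_sum Ints_mult[OF Ints_mult[OF Ints_of_nat]] less) auto
    moreover have "fact n * (F * G) $ n \<in> \<int>" using assms(1) by (simp add: hurwitz_def)
    ultimately show ?case using Ints_diff by fastforce
  qed
qed

lemma hurwitz_deriv: "hurwitz F \<Longrightarrow> hurwitz (fps_deriv F)"
  unfolding hurwitz_def
proof (intro allI)
  fix n assume "\<forall>n. fact n * F $ n \<in> \<int>"
  then have "fact (Suc n) * F $ Suc n \<in> \<int>" by blast
  then show "fact n * fps_deriv F $ n \<in> \<int>" by (simp add: algebra_simps)
qed

lemma hurwitz_of_deriv: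
  assumes "hurwitz (fps_deriv F)" "F $ 0 \<in> \<int>"
  shows "hurwitz F"
  unfolding hurwitz_def
proof
  fix n show "fact n * F $ n \<in> \<int>"
  proof (cases n)
    case (Suc m)
    have "fact m * fps_deriv F $ m \<in> \<int>" using assms by (simp add: hurwitz_def)
    then show ?thesis by (simp add: Suc algebra_simps)
  qed (use assms in simp)
qed

text \<open>The derivative of the divided power with exponent \<open>Suc m\<close> is the one with
  exponent \<open>m\<close> times \<open>fps_deriv W\<close>, hence Hurwitz by induction.
  Integrating it back only requires an integral constant term, which \<open>W $ 0 = 0\<close>
  provides.\<close>

lemma hurwitz_divided_power:
  assumes "hurwitz W" "W $ 0 = 0"
  shows "hurwitz (fps_const (1 / fact m) * W ^ m)"
proof (induction m)
  case 0
  show ?case by (auto simp: hurwitz_def)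
next
  case (Suc m)
  have *: "1 / fact (Suc m) * real (Suc m) = 1 / fact m"
    by (simp only: fact_Suc of_nat_mult) simp
  have "fps_deriv (fps_const (1 / fact (Suc m)) * W ^ Suc m) =
      (fps_const (1 / fact (Suc m)) * fps_const (of_nat (Suc m))) * W ^ m * fps_deriv W"
    unfolding fps_deriv_mult_const_left fps_deriv_power diff_Suc_1 by (simp only: mult_ac)
  also have "fps_const (1 / fact (Suc m)) * fps_const (of_nat (Suc m)) = fps_const (1 / fact m :: real)"
    using * by (simp only: fps_const_mult)
  finally have "fps_deriv (fps_const (1 / fact (Suc m)) * W ^ Suc m) =
      fps_const (1 / fact m) * W ^ m * fps_deriv W" .
  then have "hurwitz (fps_deriv (fps_const (1 / fact (Suc m)) * W ^ Suc m))"
    using hurwitz_mult[OF Suc hurwitz_deriv[OF assms(1)]] by (simp only:)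
  moreover have "(fps_const (1 / fact (Suc m)) * W ^ Suc m) $ 0 = 0"
    by (simp only: power_Suc fps_mult_nth_0 assms(2) mult_zero_left mult_zero_right)
  ultimately show ?case using hurwitz_of_deriv by (metis Ints_0)
qed

section \<open>Coefficients of the two hypergeometric series and integrality of
  \<open>r\<close>\<close>

abbreviation hyp_even :: "real fps" where "hyp_even \<equiv> fps_hypergeo [1/4, 1/4] [1/2] 4"
abbreviation hyp_odd :: "real fps" where "hyp_odd \<equiv> fps_hypergeo [3/4, 3/4] [3/2] 4"

declare fps_hypergeo_nth [simp del]

text \<open>Denominators are cleared so that the left factor is the quotient of
  \<open>fact (2 * n + 2)\<close> by \<open>fact (2 * n)\<close>. Integrality, positivity and the
  differential equation are all read off from this form.\<close>

lemma hyp_even_rec: "(2 * real n + 1) * (2 * real n + 2) * hyp_even $ Suc n = (4 * real n + 1)\<^sup>2 * hyp_even $ n"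
proof -
  have "1/2 + real n \<noteq> 0" "real n + 1 \<noteq> 0" by linarith+
  then have "hyp_even $ Suc n * ((1/2 + real n) * (real n + 1)) = 4 * (1/4 + real n)\<^sup>2 * hyp_even $ n"
    unfolding fps_hypergeo_rec by (simp add: power2_eq_square add.commute)
  moreover have "(2 * real n + 1) * (2 * real n + 2) * hyp_even $ Suc n =
      4 * (hyp_even $ Suc n * ((1/2 + real n) * (real n + 1)))" by (simp add: algebra_simps)
  ultimately show ?thesis by (simp add: algebra_simps power2_eq_square)
qed

lemma hyp_odd_rec: "(2 * real n + 2) * (2 * real n + 3) * hyp_odd $ Suc n = (4 * real n + 3)\<^sup>2 * hyp_odd $ n"
proof -
  have "3/2 + real n \<noteq> 0" "real n + 1 \<noteq> 0" by linarith+
  then have "hyp_odd $ Suc n * ((3/2 + real n) * (real n + 1)) = 4 * (3/4 + real n)\<^sup>2 * hyp_odd $ n"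
    unfolding fps_hypergeo_rec by (simp add: power2_eq_square add.commute)
  moreover have "(2 * real n + 2) * (2 * real n + 3) * hyp_odd $ Suc n =
      4 * (hyp_odd $ Suc n * ((3/2 + real n) * (real n + 1)))" by (simp add: algebra_simps)
  ultimately show ?thesis by (simp add: algebra_simps power2_eq_square)
qed

lemma hyp_even_pos: "hyp_even $ n > 0"
proof (induction n)
  case (Suc n)
  then have "0 < (2 * real n + 1) * (2 * real n + 2) * hyp_even $ Suc n"
    unfolding hyp_even_rec by simp
  moreover have "0 < (2 * real n + 1) * (2 * real n + 2)" by (intro mult_pos_pos) auto
  ultimately show ?case by (rule zero_less_mult_pos)
qed simp

lemma hyp_odd_pos: "hyp_odd $ n > 0"
proof (induction n)
  case (Suc n)
  then have "0 < (2 * real n + 2) * (2 * real n + 3) * hyp_odd $ Suc n"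
    unfolding hyp_odd_rec by simp
  moreover have "0 < (2 * real n + 2) * (2 * real n + 3)" by (intro mult_pos_pos) auto
  ultimately show ?case by (rule zero_less_mult_pos)
qed simp

lemma U_mult_hyp_even: "U * hyp_even = hyp_odd"
  by (simp add: U_def fps_divide_unit mult.assoc inverse_mult_eq_1)

lemma fact_hyp_even_Ints: "fact (2 * n) * hyp_even $ n \<in> \<int>"
proof (induction n)
  case (Suc n)
  have "fact (2 * Suc n) * hyp_even $ Suc n = (4 * real n + 1)\<^sup>2 * (fact (2 * n) * hyp_even $ n)"
    using arg_cong[OF hyp_even_rec, of "\<lambda>x. fact (2 * n) * x" n] by (simp add: mult_ac add_ac)
  moreover have "(4 * real n + 1)\<^sup>2 \<in> \<int>" by simp
  ultimately show ?case using Suc by (simp only: Ints_mult)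
qed simp

lemma fact_hyp_odd_Ints: "fact (2 * n + 1) * hyp_odd $ n \<in> \<int>"
proof (induction n)
  case (Suc n)
  have "fact (2 * Suc n + 1) * hyp_odd $ Suc n = (4 * real n + 3)\<^sup>2 * (fact (2 * n + 1) * hyp_odd $ n)"
    using arg_cong[OF hyp_odd_rec, of "\<lambda>x. fact (2 * n + 1) * x" n] by (simp add: mult_ac add_ac)
  moreover have "(4 * real n + 3)\<^sup>2 \<in> \<int>" by simp
  ultimately show ?case using Suc by (simp only: Ints_mult)
qed simp

lemma fps_compose_scaled_square_nth:
  fixes F :: "'a::field fps"
  shows "(F oo (fps_const c * fps_X ^ 2)) $ n = (if even n then c ^ (n div 2) * F $ (n div 2) else 0)"
proof -
  have "(F oo (fps_const c * fps_X ^ 2)) $ n =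
      (\<Sum>i=0..n. F $ i * (c ^ i * (if n = 2 * i then 1 else 0)))"
    by (simp add: fps_compose_nth power_mult_distrib fps_const_power fps_X_power_iff[of "2 * _"]
        del: fps_X_power_iff flip: power_mult)
  also have "\<dots> = (\<Sum>i=0..n. if even n \<and> i = n div 2 then c ^ (n div 2) * F $ (n div 2) else 0)"
    by (intro sum.cong refl) auto
  also have "\<dots> = (if even n then c ^ (n div 2) * F $ (n div 2) else 0)"
    by simp
  finally show ?thesis .
qed

text \<open>After \<open>t = 2 * y ^ 2\<close>, the series \<open>W\<close>, which is
  \<open>y\<close> times \<open>U\<close>, is a quotient of two Hurwitz series. The number
  \<open>r n k\<close> is \<open>fact (2 * n)\<close> times the coefficient of
  \<open>y ^ (2 * n)\<close> in the divided power of \<open>W\<close> with exponent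
  \<open>2 * k\<close>; the substitution supplies the factor \<open>2 ^ (n - k)\<close>.\<close>

lemma r_Ints:
  assumes "k \<le> n"
  shows "r n k \<in> \<int>"
proof -
  define c :: "real fps" where "c = fps_const 2 * fps_X ^ 2"
  have c0: "c $ 0 = 0" by (simp add: c_def)
  note c_nth = fps_compose_scaled_square_nth[where c = "2::real", folded c_def]
  define W where "W = fps_X * (U oo c)"
  have "hurwitz (hyp_even oo c)"
    unfolding hurwitz_def
  proof
    fix n show "fact n * (hyp_even oo c) $ n \<in> \<int>"
    proof (cases "even n")
      case True
      then obtain j where n: "n = 2 * j" by (rule evenE)
      have "2 ^ j * (fact (2 * j) * hyp_even $ j) \<in> \<int>" by (rule Ints_mult[OF _ fact_hyp_even_Ints]) simp
      then show ?thesis unfolding n c_nth by (simp add: mult.left_commute)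
    qed (simp add: c_nth)
  qed
  moreover have "hurwitz (fps_X * (hyp_odd oo c))"
    unfolding hurwitz_def
  proof
    fix n show "fact n * (fps_X * (hyp_odd oo c)) $ n \<in> \<int>"
    proof (cases "even n")
      case True
      then show ?thesis by (cases "n = 0") (auto simp: c_nth)
    next
      case False
      then obtain j where n: "n = 2 * j + 1" by (rule oddE)
      have "2 ^ j * (fact (2 * j + 1) * hyp_odd $ j) \<in> \<int>" by (rule Ints_mult[OF _ fact_hyp_odd_Ints]) simp
      moreover have "(fps_X * (hyp_odd oo c)) $ n = 2 ^ j * hyp_odd $ j" unfolding n by (simp add: c_nth)
      ultimately show ?thesis unfolding n by (simp only: mult.left_commute)
    qed
  qed
  moreover have "W * (hyp_even oo c) = fps_X * (hyp_odd oo c)"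
    by (simp add: W_def mult.assoc c0 U_mult_hyp_even flip: fps_compose_mult_distrib)
  moreover have "(hyp_even oo c) $ 0 = 1" by (simp add: c_nth)
  ultimately have "hurwitz W" by (metis hurwitz_cancel_right)
  then have "hurwitz (fps_const (1 / fact (2 * k)) * W ^ (2 * k))"
    by (rule hurwitz_divided_power) (simp add: W_def)
  then have "fact (2 * n) * (fps_const (1 / fact (2 * k)) * W ^ (2 * k)) $ (2 * n) \<in> \<int>"
    by (simp add: hurwitz_def)
  also have "W ^ (2 * k) = fps_X ^ (2 * k) * (U ^ (2 * k) oo c)"
    by (simp add: W_def power_mult_distrib fps_compose_power[OF c0])
  also have "fact (2 * n) * (fps_const (1 / fact (2 * k)) * (fps_X ^ (2 * k) * (U ^ (2 * k) oo c))) $ (2 * n)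
     = r n k"
    using assms by (simp add: fps_X_power_mult_nth c_nth r_def flip: diff_mult_distrib2)
  finally show ?thesis .
qed

section \<open>Theta constants as power series\<close>

definition theta3_series :: "real fps" where
  "theta3_series = Abs_fps (\<lambda>k. of_nat (card {n::int. n ^ 2 = int k}))"

definition lattice_circle :: "nat \<Rightarrow> (int \<times> int) set" where
  "lattice_circle k = {(m, n). m ^ 2 + n ^ 2 = int k}"

lemma finite_int_square_le: "finite {n::int. n ^ 2 \<le> int k}"
proof (rule finite_subset)
  show "{n::int. n ^ 2 \<le> int k} \<subseteq> {- int k..int k}"
  proof
    fix n :: int assume "n \<in> {n. n ^ 2 \<le> int k}"
    then have "\<bar>n\<bar> * \<bar>n\<bar> \<le> int k" by (simp add: power2_eq_square)
    moreover have "\<bar>n\<bar> \<le> \<bar>n\<bar> * \<bar>n\<bar>" 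
    proof (cases "n = 0")
      case False
      then have "1 * \<bar>n\<bar> \<le> \<bar>n\<bar> * \<bar>n\<bar>" by (intro mult_right_mono) auto
      then show ?thesis by simp
    qed simp
    ultimately show "n \<in> {- int k..int k}" by auto
  qed
qed simp

lemma finite_lattice_circle: "finite (lattice_circle k)"
proof (rule finite_subset)
  show "lattice_circle k \<subseteq> {n. n ^ 2 \<le> int k} \<times> {n. n ^ 2 \<le> int k}"
  proof
    fix p assume "p \<in> lattice_circle k"
    then have "(fst p)\<^sup>2 + (snd p)\<^sup>2 = int k" by (auto simp: lattice_circle_def)
    moreover have "0 \<le> (fst p)\<^sup>2" "0 \<le> (snd p)\<^sup>2" by auto
    ultimately have "(fst p)\<^sup>2 \<le> int k" "(snd p)\<^sup>2 \<le> int k" by linarith+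
    then show "p \<in> {n. n ^ 2 \<le> int k} \<times> {n. n ^ 2 \<le> int k}"
      by (simp add: mem_Times_iff)
  qed
qed (simp add: finite_int_square_le)

text \<open>A weighted Cauchy product: the weight 1 yields the coefficients of the square of
  \<open>theta3_series\<close>, and the weight \<open>(-1) ^ i\<close> those of its product with its
  image under the sign change of the nome.\<close>

lemma sum_over_lattice_circle:
  "(\<Sum>i\<le>k. f i * (theta3_series $ i * theta3_series $ (k - i))) = (\<Sum>(m, n)\<in>lattice_circle k. f (nat (m ^ 2)))"
proof -
  have "(\<Sum>p\<in>lattice_circle k. f (nat (fst p ^ 2))) =
      (\<Sum>i\<le>k. \<Sum>p | p \<in> lattice_circle k \<and> nat (fst p ^ 2) = i. f (nat (fst p ^ 2)))"
  proof (rule sum.group[symmetric])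
    show "(\<lambda>p. nat (fst p ^ 2)) ` lattice_circle k \<subseteq> {..k}"
      by (auto simp: lattice_circle_def nat_le_iff)
         (smt (verit) zero_le_power2)
  qed (auto simp: finite_lattice_circle)
  also have "\<dots> = (\<Sum>i\<le>k. f i * (theta3_series $ i * theta3_series $ (k - i)))"
  proof (intro sum.cong refl)
    fix i assume i: "i \<in> {..k}"
    have "{p \<in> lattice_circle k. nat (fst p ^ 2) = i} =
        {n. n ^ 2 = int i} \<times> {n. n ^ 2 = int (k - i)}"
      using i by (auto simp: lattice_circle_def of_nat_diff)
    then have "real (card {p \<in> lattice_circle k. nat (fst p ^ 2) = i}) = theta3_series $ i * theta3_series $ (k - i)"
      by (simp add: theta3_series_def card_cartesian_product)
    moreover have "(\<Sum>p | p \<in> lattice_circle k \<and> nat (fst p ^ 2) = i. f (nat (fst p ^ 2))) =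
        (\<Sum>p | p \<in> lattice_circle k \<and> nat (fst p ^ 2) = i. f i)"
      by (intro sum.cong) auto
    ultimately show "(\<Sum>p | p \<in> lattice_circle k \<and> nat (fst p ^ 2) = i. f (nat (fst p ^ 2))) =
        f i * (theta3_series $ i * theta3_series $ (k - i))"
      by simp
  qed
  finally show ?thesis by (simp add: case_prod_beta)
qed

text \<open>Rotation by 45 degrees combined with scaling by \<open>sqrt 2\<close>. It is onto
  because an even sum of two squares has summands of equal parity.\<close>

lemma bij_lattice_circle_double:
  "bij_betw (\<lambda>(u, v). (u + v, u - v)) (lattice_circle j) (lattice_circle (2 * j))"
proof (rule bij_betwI[where g = "\<lambda>(m, n). ((m + n) div 2, (m - n) div 2)"])
  have *: "(u + v)\<^sup>2 + (u - v)\<^sup>2 = 2 * (u\<^sup>2 + v\<^sup>2)" for u v :: int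
    by (simp add: power2_eq_square algebra_simps)
  show "(\<lambda>(u, v). (u + v, u - v)) \<in> lattice_circle j \<rightarrow> lattice_circle (2 * j)"
    by (auto simp: lattice_circle_def *)
  have even: "even (m + n) \<and> even (m - n)" if "(m, n) \<in> lattice_circle (2 * j)" for m n
  proof -
    have "even (m\<^sup>2 + n\<^sup>2)" using that by (simp add: lattice_circle_def)
    then show ?thesis by simp
  qed
  show "(\<lambda>(m, n). ((m + n) div 2, (m - n) div 2)) \<in> lattice_circle (2 * j) \<rightarrow> lattice_circle j"
  proof (clarify)
    fix m n assume mn: "(m, n) \<in> lattice_circle (2 * j)"
    obtain u v where uv: "m + n = 2 * u" "m - n = 2 * v" using even[OF mn] unfolding dvd_def by blast
    then have "m = u + v" "n = u - v" by auto
    then show "((m + n) div 2, (m - n) div 2) \<in> lattice_circle j"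
      using mn * by (auto simp: lattice_circle_def)
  qed
  show "(case case x of (k, l) \<Rightarrow> (k + l, k - l) of (m, n) \<Rightarrow> ((m + n) div 2, (m - n) div 2)) = x"
    for x :: "int \<times> int" by (cases x) simp
  fix y assume y: "y \<in> lattice_circle (2 * j)"
  obtain m n where mn: "y = (m, n)" by (cases y)
  obtain k l where "m + n = 2 * k" "m - n = 2 * l"
    using even[of m n] y unfolding mn dvd_def by blast
  then show "(case case y of (m, n) \<Rightarrow> ((m + n) div 2, (m - n) div 2) of (k, l) \<Rightarrow> (k + l, k - l)) = y"
    unfolding mn by simp
qed

text \<open>\<open>\<theta>\<^sub>3\<^sup>2\<close> and \<open>\<theta>\<^sub>4\<^sup>2\<close> in the nome \<open>q\<close>; the sign change \<open>q \<mapsto> - q\<close> interchanges them.\<close>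

definition theta3_sq :: "real fps" where "theta3_sq = theta3_series ^ 2"
definition theta4_sq :: "real fps" where "theta4_sq = (theta3_series oo - fps_X) ^ 2"

lemma theta3_sq_nth: "theta3_sq $ k = card (lattice_circle k)"
  using sum_over_lattice_circle[of "\<lambda>_. 1" k]
  by (simp add: theta3_sq_def power2_eq_square fps_mult_nth atLeast0AtMost case_prod_beta)

lemma theta4_sq_eq: "theta4_sq = theta3_sq oo - fps_X"
  by (simp add: theta3_sq_def theta4_sq_def fps_compose_power)

lemma fps_compose_uminus_X_nth: "((F :: real fps) oo - fps_X) $ n = (-1) ^ n * F $ n"
  by (simp add: fps_compose_uminus')

lemma fps_compose_X_square_nth:
  "((F :: real fps) oo fps_X ^ 2) $ n = (if even n then F $ (n div 2) else 0)"
  using fps_compose_scaled_square_nth[of F 1 n] by simp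

lemma theta4_sq_nth: "theta4_sq $ k = (-1) ^ k * card (lattice_circle k)"
  by (simp add: theta4_sq_eq fps_compose_uminus_X_nth theta3_sq_nth)

text \<open>On the right the odd coefficients cancel and the even ones double; \<open>2 * j\<close>
  and \<open>j\<close> have equally many representations as a sum of two squares.\<close>

lemma theta3_sq_doubling: "2 * (theta3_sq oo fps_X ^ 2) = theta3_sq + theta4_sq"
proof (rule fps_ext)
  fix n
  show "(2 * (theta3_sq oo fps_X ^ 2)) $ n = (theta3_sq + theta4_sq) $ n"
  proof (cases "even n")
    case True
    then obtain j where "n = 2 * j" by (rule evenE)
    then show ?thesis using bij_betw_same_card[OF bij_lattice_circle_double[of j]]
      by (simp add: fps_compose_X_square_nth theta3_sq_nth theta4_sq_nth)
  qed (simp add: fps_compose_X_square_nth theta3_sq_nth theta4_sq_nth)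
qed

lemma theta3_series_mult_T_uminus: "theta3_series * (theta3_series oo - fps_X) = theta4_sq oo fps_X ^ 2"
proof (rule fps_ext)
  fix n
  define s where "s = (\<Sum>(m, l)\<in>lattice_circle n. (-1::real) ^ nat (m ^ 2))"
  have s: "((theta3_series oo - fps_X) * theta3_series) $ n = s"
    unfolding s_def sum_over_lattice_circle[symmetric]
    by (simp add: fps_mult_nth atLeast0AtMost fps_compose_uminus_X_nth mult.assoc)
  show "(theta3_series * (theta3_series oo - fps_X)) $ n = (theta4_sq oo fps_X ^ 2) $ n"
  proof (cases "even n")
    case True
    then obtain j where n: "n = 2 * j" by (rule evenE)
    \<comment> \<open>In the rotated coordinates the sign depends on the parity of
      \<open>u + v\<close>, which is that of \<open>u ^ 2 + v ^ 2 = j\<close>, so it is constant on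
      the circle.\<close>
    have "s = (\<Sum>(u, v)\<in>lattice_circle j. (-1) ^ nat ((u + v) ^ 2))"
      unfolding s_def n by (subst sum.reindex_bij_betw[OF bij_lattice_circle_double, symmetric])
        (auto intro!: sum.cong)
    also have "\<dots> = (\<Sum>(u, v)\<in>lattice_circle j. (-1) ^ j)"
    proof (intro sum.cong refl, clarify)
      fix u v assume "(u, v) \<in> lattice_circle j"
      then have "int j = u\<^sup>2 + v\<^sup>2" by (simp add: lattice_circle_def)
      then have "even (int j) \<longleftrightarrow> even ((u + v)\<^sup>2)" by simp
      then have "even j \<longleftrightarrow> even (nat ((u + v)\<^sup>2))" by (simp add: even_nat_iff)
      then show "(-1::real) ^ nat ((u + v)\<^sup>2) = (-1) ^ j" by (simp add: minus_one_power_iff)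
    qed
    finally show ?thesis using s n
      by (simp add: mult.commute[of theta3_series] fps_compose_X_square_nth theta4_sq_nth case_prod_beta)
  next
    case False
    \<comment> \<open>For odd \<open>n\<close> exactly one coordinate is odd, so exchanging the
      coordinates reverses every sign and \<open>s = - s\<close>.\<close>
    have "s = (\<Sum>(m, l)\<in>lattice_circle n. (-1) ^ nat (l ^ 2))"
      unfolding s_def
      by (rule sum.reindex_bij_witness[of _ prod.swap prod.swap])
         (auto simp: lattice_circle_def add.commute)
    also have "\<dots> = (\<Sum>(m, l)\<in>lattice_circle n. - ((-1) ^ nat (m ^ 2)))"
    proof (intro sum.cong refl, clarify)
      fix m l assume "(m, l) \<in> lattice_circle n"
      then have "int n = m\<^sup>2 + l\<^sup>2" by (simp add: lattice_circle_def)
      then have "odd (int n) \<longleftrightarrow> (even (m\<^sup>2) \<longleftrightarrow> odd (l\<^sup>2))" by auto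
      then have "even (nat (m\<^sup>2)) \<longleftrightarrow> odd (nat (l\<^sup>2))" using False by (simp add: even_nat_iff)
      then show "(-1::real) ^ nat (l\<^sup>2) = - ((-1) ^ nat (m\<^sup>2))" by (simp add: minus_one_power_iff)
    qed
    also have "\<dots> = - s" unfolding s_def by (simp add: sum_negf case_prod_beta)
    finally have "s = 0" by simp
    then show ?thesis using s False by (simp add: mult.commute[of theta3_series] fps_compose_X_square_nth)
  qed
qed

lemma theta4_sq_doubling: "(theta4_sq oo fps_X ^ 2) ^ 2 = theta3_sq * theta4_sq"
  unfolding theta3_series_mult_T_uminus[symmetric] by (simp add: theta3_sq_def theta4_sq_def power_mult_distrib)

lemma lattice_circle_0: "lattice_circle 0 = {(0, 0)}"
  by (auto simp: lattice_circle_def sum_power2_eq_zero_iff)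

lemma lattice_circle_1: "lattice_circle 1 = {(1, 0), (-1, 0), (0, 1), (0, -1)}"
proof -
  have "(m, n) \<in> {(1, 0), (-1, 0), (0, 1), (0, -1)}" if "(m, n) \<in> lattice_circle 1" for m n
  proof -
    have mn: "m\<^sup>2 + n\<^sup>2 = 1" using that by (simp add: lattice_circle_def)
    moreover have "0 \<le> m\<^sup>2" "0 \<le> n\<^sup>2" by auto
    ultimately have "m\<^sup>2 = 0 \<and> n\<^sup>2 = 1 \<or> m\<^sup>2 = 1 \<and> n\<^sup>2 = 0" by linarith
    then show ?thesis by (auto simp: power2_eq_1_iff)
  qed
  then show ?thesis by (auto simp: lattice_circle_def)
qed

lemma theta3_sq_nth_0: "theta3_sq $ 0 = 1" and theta3_sq_nth_1: "theta3_sq $ 1 = 4"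
  and theta4_sq_nth_0: "theta4_sq $ 0 = 1" and theta4_sq_nth_1: "theta4_sq $ 1 = -4"
  using lattice_circle_1 by (simp_all add: theta3_sq_nth theta4_sq_nth lattice_circle_0)

section \<open>The Euler operator and the differential relations between the squared theta
  constants\<close>

definition theta_D :: "real fps \<Rightarrow> real fps" where "theta_D F = fps_X * fps_deriv F"

lemma theta_D_nth: "theta_D F $ n = real n * F $ n"
  by (cases n) (simp_all add: theta_D_def)

lemma theta_D_simps:
  "theta_D (F + G) = theta_D F + theta_D G"
  "theta_D (F - G) = theta_D F - theta_D G"
  "theta_D (F * G) = theta_D F * G + F * theta_D G"
  "theta_D (numeral n) = 0"
  "theta_D (fps_const c * F) = fps_const c * theta_D F"
  "theta_D (F ^ 2) = 2 * (F * theta_D F)"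
  by (simp_all add: theta_D_def algebra_simps fps_deriv_numeral power2_eq_square)

lemma theta_D_doubling: "theta_D (F oo fps_X ^ 2) = 2 * (theta_D F oo fps_X ^ 2)"
proof (rule fps_ext)
  fix n show "theta_D (F oo fps_X ^ 2) $ n = (2 * (theta_D F oo fps_X ^ 2)) $ n"
    by (cases "even n") (auto simp: theta_D_nth fps_compose_X_square_nth)
qed

lemma X_square_compose_simps:
  fixes F G :: "real fps"
  shows "(F * G) oo fps_X ^ 2 = (F oo fps_X ^ 2) * (G oo fps_X ^ 2)"
    "(F + G) oo fps_X ^ 2 = (F oo fps_X ^ 2) + (G oo fps_X ^ 2)"
    "(F - G) oo fps_X ^ 2 = (F oo fps_X ^ 2) - (G oo fps_X ^ 2)"
    "(F ^ k) oo fps_X ^ 2 = (F oo fps_X ^ 2) ^ k"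
    "(numeral m * F) oo fps_X ^ 2 = numeral m * (F oo fps_X ^ 2)"
  by (simp_all add: fps_compose_mult_distrib fps_compose_add_distrib fps_compose_sub_distrib
      fps_compose_power)

text \<open>By Jacobi's identity this is the fourth power of \<open>\<theta>\<^sub>2\<close>.\<close>

definition theta2_pow4 :: "real fps" where "theta2_pow4 = theta3_sq ^ 2 - theta4_sq ^ 2"

lemma theta3_sq_nonzero: "theta3_sq \<noteq> 0" and theta4_sq_nonzero: "theta4_sq \<noteq> 0"
  using theta3_sq_nth_0 theta4_sq_nth_0 by auto

lemma subdegree_X_square_compose: "subdegree ((F :: real fps) oo fps_X ^ 2) = 2 * subdegree F"
proof (cases "F = 0")
  case False
  then show ?thesis
    by (intro subdegreeI) (auto simp: fps_compose_X_square_nth elim!: evenE)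
qed simp

lemma theta3_sq_minus_theta4_sq_subdegree: "subdegree (theta3_sq - theta4_sq) = 1"
  by (intro subdegreeI) (use theta3_sq_nth_1 theta4_sq_nth_1 in \<open>auto simp: theta3_sq_nth_0 theta4_sq_nth_0\<close>)

text \<open>The defect \<open>Z\<close> satisfies
  \<open>8 * b1 * Z1 = (theta3_sq - theta4_sq) * Z\<close>, where \<open>Z1\<close> is
  \<open>Z\<close> at the squared nome and \<open>b1\<close> is a unit. If \<open>Z\<close> had
  subdegree \<open>m\<close>, then \<open>2 * m = m + 1\<close>; but the coefficients of
  \<open>Z\<close> at 0 and 1 vanish.\<close>

lemma theta_wronskian: "2 * (theta4_sq * theta_D theta3_sq - theta3_sq * theta_D theta4_sq) = theta3_sq * theta4_sq * theta2_pow4"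
proof -
  define Z where "Z = 2 * (theta4_sq * theta_D theta3_sq - theta3_sq * theta_D theta4_sq) - theta3_sq * theta4_sq * theta2_pow4"
  \<comment> \<open>The suffix \<open>1\<close> marks the substitution of the squared nome.\<close>
  define a1 b1 Da1 Db1 Z1 where "a1 = theta3_sq oo fps_X ^ 2" and "b1 = theta4_sq oo fps_X ^ 2"
    and "Da1 = theta_D theta3_sq oo fps_X ^ 2" and "Db1 = theta_D theta4_sq oo fps_X ^ 2" and "Z1 = Z oo fps_X ^ 2"
  have a1: "2 * a1 = theta3_sq + theta4_sq" and b1: "b1 ^ 2 = theta3_sq * theta4_sq"
    using theta3_sq_doubling theta4_sq_doubling by (simp_all add: a1_def b1_def)
  have Da1: "4 * Da1 = theta_D theta3_sq + theta_D theta4_sq"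
    using arg_cong[OF a1, of theta_D] by (simp add: theta_D_simps theta_D_doubling a1_def Da1_def)
  have Db1: "4 * (b1 * Db1) = theta_D theta3_sq * theta4_sq + theta3_sq * theta_D theta4_sq"
    using arg_cong[OF b1, of theta_D]
    by (simp add: theta_D_simps theta_D_doubling b1_def Db1_def mult.left_commute)
  have Z1: "Z1 = 2 * (b1 * Da1 - a1 * Db1) - a1 * b1 * (a1 ^ 2 - b1 ^ 2)"
    by (simp add: Z1_def Z_def theta2_pow4_def X_square_compose_simps a1_def b1_def Da1_def Db1_def)
  have "8 * b1 * Z1 = 4 * (b1 ^ 2) * (4 * Da1) - 2 * (2 * a1) * (4 * (b1 * Db1))
      - b1 ^ 2 * (2 * a1) * ((2 * a1) ^ 2 - 4 * b1 ^ 2)"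
    unfolding Z1 by algebra
  also have "\<dots> = (theta3_sq - theta4_sq) * Z"
    unfolding Z_def theta2_pow4_def a1 Da1 Db1 b1 by algebra
  finally have eq: "8 * b1 * Z1 = (theta3_sq - theta4_sq) * Z" .
  have "Z = 0"
  proof (rule ccontr)
    assume "Z \<noteq> 0"
    have b10: "b1 $ 0 = 1" by (simp add: b1_def fps_compose_X_square_nth theta4_sq_nth_0)
    have "Z $ 0 = 0" "Z $ 1 = 0"
      using theta3_sq_nth_1 theta4_sq_nth_1
      by (simp_all add: Z_def theta2_pow4_def theta_D_nth theta3_sq_nth_0 theta4_sq_nth_0 fps_mult_nth_1
          power2_eq_square)
    then have "subdegree Z \<noteq> 0" "subdegree Z \<noteq> 1"
      using \<open>Z \<noteq> 0\<close> by (metis nth_subdegree_nonzero)+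
    moreover have "subdegree (8 * b1 * Z1) = 2 * subdegree Z"
    proof -
      have "Z1 \<noteq> 0" using \<open>Z \<noteq> 0\<close> eq theta3_sq_minus_theta4_sq_subdegree by auto
      moreover have "8 * b1 \<noteq> 0" "subdegree (8 * b1) = 0"
        using b10 by (auto simp: subdegree_eq_0_iff)
      ultimately show ?thesis by (simp add: Z1_def subdegree_X_square_compose subdegree_mult)
    qed
    moreover have "subdegree ((theta3_sq - theta4_sq) * Z) = 1 + subdegree Z"
      using \<open>Z \<noteq> 0\<close> theta3_sq_minus_theta4_sq_subdegree by (subst subdegree_mult) auto
    ultimately show False using eq by simp
  qed
  then show ?thesis by (simp add: Z_def)
qed

definition theta3_sq_dlog :: "real fps" where "theta3_sq_dlog = theta_D theta3_sq / theta3_sq"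

lemma theta_D_theta3_sq: "theta_D theta3_sq = theta3_sq * theta3_sq_dlog"
  using theta3_sq_nth_0 by (simp add: theta3_sq_dlog_def fps_divide_unit mult.left_commute inverse_mult_eq_1')

lemma theta_D_theta4_sq: "2 * theta_D theta4_sq = theta4_sq * (2 * theta3_sq_dlog - theta2_pow4)"
proof -
  have "theta3_sq * (2 * theta_D theta4_sq) = theta3_sq * (theta4_sq * (2 * theta3_sq_dlog - theta2_pow4))"
    using theta_wronskian unfolding theta_D_theta3_sq by algebra
  then show ?thesis using theta3_sq_nonzero by simp
qed

text \<open>Doubling shows that the defect \<Delta> is 4 times its own image under squaring the
  nome. Hence its odd coefficients vanish, its constant term equals 4 times itself, and the
  remaining even coefficients vanish by induction on the index.\<close>

lemma theta_D_theta3_sq_dlog: "4 * theta_D theta3_sq_dlog = 4 * theta3_sq_dlog ^ 2 + theta4_sq ^ 2 * theta2_pow4"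
proof -
  \<comment> \<open>\<open>B\<close> is the logarithmic derivative of
    \<open>theta4_sq\<close>.\<close>
  define B where "B = theta3_sq_dlog - fps_const (1/2) * theta2_pow4"
  have B: "2 * B = 2 * theta3_sq_dlog - theta2_pow4"
    by (simp add: B_def algebra_simps flip: numeral_fps_const mult.assoc)
  have Db: "theta_D theta4_sq = theta4_sq * B"
    using theta_D_theta4_sq unfolding B[symmetric] by simp
  define \<Delta> where "\<Delta> = 4 * theta_D theta3_sq_dlog - 4 * theta3_sq_dlog ^ 2 - theta4_sq ^ 2 * theta2_pow4"
  have Dc2: "theta_D theta2_pow4 = 2 * theta3_sq ^ 2 * theta3_sq_dlog - 2 * theta4_sq ^ 2 * B"
    by (simp add: theta2_pow4_def theta_D_simps theta_D_theta3_sq Db) (simp add: power2_eq_square mult_ac)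
  have DB: "2 * theta_D B = 2 * theta_D theta3_sq_dlog - (2 * theta3_sq ^ 2 * theta3_sq_dlog - 2 * theta4_sq ^ 2 * B)"
    using arg_cong[OF B, of theta_D] by (simp add: theta_D_simps flip: Dc2)
  \<comment> \<open>The same defect expressed through \<open>B\<close>. The mean of both expressions
    is symmetric in \<open>theta3_sq\<close> and \<open>theta4_sq\<close>, which is the shape that
    the doubling relations produce.\<close>
  have \<Delta>: "\<Delta> = 4 * theta_D B - 4 * B ^ 2 + theta3_sq ^ 2 * theta2_pow4"
    using DB B unfolding \<Delta>_def theta2_pow4_def by algebra
  define a1 b1 B1 DB1 \<Delta>1 where "a1 = theta3_sq oo fps_X ^ 2" and "b1 = theta4_sq oo fps_X ^ 2"
    and "B1 = B oo fps_X ^ 2" and "DB1 = theta_D B oo fps_X ^ 2" and "\<Delta>1 = \<Delta> oo fps_X ^ 2"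
  have a1: "2 * a1 = theta3_sq + theta4_sq" and b1: "b1 ^ 2 = theta3_sq * theta4_sq"
    using theta3_sq_doubling theta4_sq_doubling by (simp_all add: a1_def b1_def)
  have "2 * (theta_D theta4_sq oo fps_X ^ 2) = theta_D b1" by (simp add: b1_def theta_D_doubling)
  then have Db1: "2 * (b1 * B1) = theta_D b1"
    unfolding Db by (simp add: X_square_compose_simps b1_def B1_def)
  have "4 * (b1 ^ 2 * B1) = 2 * (b1 * theta_D b1)"
    unfolding Db1[symmetric] by algebra
  also have "\<dots> = theta_D (b1 ^ 2)" by (simp add: theta_D_simps)
  also have "\<dots> = b1 ^ 2 * (theta3_sq_dlog + B)" unfolding b1 by (simp add: theta_D_simps theta_D_theta3_sq Db algebra_simps)
  finally have "b1 ^ 2 * (4 * B1) = b1 ^ 2 * (theta3_sq_dlog + B)" by (simp add: mult.left_commute)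
  then have B1: "4 * B1 = theta3_sq_dlog + B" using theta3_sq_nonzero theta4_sq_nonzero b1 by simp
  have DB1: "8 * DB1 = theta_D theta3_sq_dlog + theta_D B"
    using arg_cong[OF B1, of theta_D] by (simp add: theta_D_simps B1_def theta_D_doubling DB1_def)
  have "\<Delta>1 = 4 * DB1 - 4 * B1 ^ 2 + a1 ^ 2 * (a1 ^ 2 - b1 ^ 2)"
    by (simp add: \<Delta>1_def \<Delta> theta2_pow4_def X_square_compose_simps a1_def b1_def B1_def DB1_def)
  then have "16 * \<Delta>1 = 8 * (8 * DB1) - 4 * (4 * B1) ^ 2 + (2 * a1) ^ 2 * ((2 * a1) ^ 2 - 4 * b1 ^ 2)"
    by algebra
  also have "\<dots> = 4 * \<Delta>"
    using B DB \<Delta> unfolding \<Delta>_def theta2_pow4_def a1 b1 B1 DB1 by algebra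
  finally have eq: "16 * \<Delta>1 = 4 * \<Delta>" .
  have "\<Delta> $ n = 0" for n
  proof (induction n rule: less_induct)
    case (less n)
    have "4 * \<Delta>1 $ n = \<Delta> $ n" using arg_cong[OF eq, of "\<lambda>F. F $ n"] by simp
    then show ?case using less[of "n div 2"]
      by (cases "n = 0") (auto simp: \<Delta>1_def fps_compose_X_square_nth split: if_splits)
  qed
  then have "\<Delta> = 0" by (simp add: fps_eq_iff)
  then show ?thesis by (simp add: \<Delta>_def algebra_simps)
qed

section \<open>Theta functions on the imaginary axis\<close>

lemma fps_conv_radius_ge_1_of_bounded:
  fixes F :: "real fps"
  assumes "\<And>n. \<bar>F $ n\<bar> \<le> C"
  shows "fps_conv_radius F \<ge> 1"
  unfolding fps_conv_radius_def
proof (rule conv_radius_geI_ex)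
  fix r :: real assume r: "0 < r" "ereal r < 1"
  have "summable (\<lambda>n. F $ n * r ^ n)"
  proof (rule summable_comparison_test')
    show "summable (\<lambda>n. C * r ^ n)" using r by (intro summable_mult summable_geometric) auto
    show "norm (F $ n * r ^ n) \<le> C * r ^ n" for n
      using assms r by (auto simp: abs_mult intro!: mult_mono)
  qed
  then show "\<exists>z. norm z = r \<and> summable (\<lambda>n. F $ n * z ^ n)" using r by (intro exI[of _ r]) auto
qed

lemma theta3_series_nth: "theta3_series $ k = (if k = 0 then 1 else if k \<in> range (\<lambda>n. n ^ 2) then 2 else 0)"
proof (cases "k \<in> range (\<lambda>n. n ^ 2)")
  case True
  then obtain j where k: "k = j ^ 2" by auto
  have "{n::int. n ^ 2 = int k} = {int j, - int j}"
    by (auto simp: k power2_eq_iff)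
  then show ?thesis using True by (cases "j = 0") (auto simp: theta3_series_def k)
next
  case False
  have "{n::int. n ^ 2 = int k} = {}"
  proof (rule ccontr)
    assume "{n::int. n ^ 2 = int k} \<noteq> {}"
    then obtain n :: int where "n ^ 2 = int k" by auto
    then have "int ((nat \<bar>n\<bar>) ^ 2) = int k" by simp
    then show False using False by (metis of_nat_eq_iff rangeI)
  qed
  moreover have "k \<noteq> 0" using False by (metis power_zero_numeral rangeI)
  ultimately show ?thesis using False by (simp add: theta3_series_def)
qed

lemma theta3_series_radius: "fps_conv_radius theta3_series \<ge> 1" and theta3_series_uminus_radius: "fps_conv_radius (theta3_series oo - fps_X) \<ge> 1"
  by (rule fps_conv_radius_ge_1_of_bounded[of _ 2];
      auto simp: theta3_series_nth fps_compose_uminus_X_nth abs_mult)+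

abbreviation unit_radius :: "real fps \<Rightarrow> bool" where
  "unit_radius F \<equiv> fps_conv_radius F \<ge> 1"

lemma unit_radius_mult: "unit_radius F \<Longrightarrow> unit_radius G \<Longrightarrow> unit_radius (F * G)"
  using fps_conv_radius_mult[of F G] by (meson min.boundedI order_trans)

lemma unit_radius_diff: "unit_radius F \<Longrightarrow> unit_radius G \<Longrightarrow> unit_radius (F - G)"
  using fps_conv_radius_diff[of F G] by (meson min.boundedI order_trans)

lemma unit_radius_power: "unit_radius F \<Longrightarrow> unit_radius (F ^ n)"
  using fps_conv_radius_power[of F n] by (rule order_trans[rotated])

lemma unit_radius_theta_D: "unit_radius F \<Longrightarrow> unit_radius (theta_D F)"
  unfolding theta_D_def
  by (intro unit_radius_mult) (use fps_conv_radius_deriv[of F] in \<open>auto intro: order_trans\<close>)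

lemma theta3_sq_radius: "unit_radius theta3_sq" and theta4_sq_radius: "unit_radius theta4_sq"
  using theta3_series_radius theta3_series_uminus_radius by (auto simp: theta3_sq_def theta4_sq_def intro: unit_radius_power)

lemma theta2_pow4_radius: "unit_radius theta2_pow4"
  by (simp add: theta2_pow4_def theta3_sq_radius theta4_sq_radius unit_radius_diff unit_radius_power)

lemmas unit_radius_intros = unit_radius_mult unit_radius_diff unit_radius_power unit_radius_theta_D
  theta3_sq_radius theta4_sq_radius theta2_pow4_radius theta3_series_radius

text \<open>In the logarithmic variable $u = \log q$ the operator \<open>theta_D\<close> becomes ordinary
  differentiation; $u$ corresponds to $-\pi x$ in the paper.\<close>

definition ev :: "real fps \<Rightarrow> real \<Rightarrow> real" where "ev F u = eval_fps F (exp u)"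

lemma exp_lt_radius: "unit_radius F \<Longrightarrow> u < 0 \<Longrightarrow> ereal (norm (exp u)) < fps_conv_radius F" for u :: real
  by (rule less_le_trans[of _ 1]) auto

lemma ev_sums: "unit_radius F \<Longrightarrow> u < 0 \<Longrightarrow> (\<lambda>n. F $ n * exp u ^ n) sums ev F u"
  unfolding ev_def by (intro sums_eval_fps exp_lt_radius)

lemma ev_mult: "unit_radius F \<Longrightarrow> unit_radius G \<Longrightarrow> u < 0 \<Longrightarrow> ev (F * G) u = ev F u * ev G u"
  unfolding ev_def by (intro eval_fps_mult exp_lt_radius)

lemma ev_diff: "unit_radius F \<Longrightarrow> unit_radius G \<Longrightarrow> u < 0 \<Longrightarrow> ev (F - G) u = ev F u - ev G u"
  unfolding ev_def by (intro eval_fps_diff exp_lt_radius)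

lemma ev_power: "unit_radius F \<Longrightarrow> u < 0 \<Longrightarrow> ev (F ^ n) u = ev F u ^ n"
  unfolding ev_def by (intro eval_fps_power exp_lt_radius)

lemma ev_numeral: "ev (numeral n) u = numeral n"
  by (simp add: ev_def)

lemma ev_deriv:
  assumes "unit_radius F" "u < 0"
  shows "(ev F has_real_derivative ev (theta_D F) u) (at u)"
proof -
  have "(eval_fps F has_real_derivative eval_fps (fps_deriv F) (exp u)) (at (exp u))"
    using assms by (intro has_field_derivative_eval_fps exp_lt_radius)
  from DERIV_chain2[OF this DERIV_exp]
  have "((\<lambda>u. eval_fps F (exp u)) has_real_derivative
      eval_fps (fps_deriv F) (exp u) * exp u) (at u)" .
  moreover have "ev (theta_D F) u = exp u * eval_fps (fps_deriv F) (exp u)"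
  proof -
    have "unit_radius (fps_deriv F)" using assms(1) fps_conv_radius_deriv[of F] by (rule order_trans)
    then show ?thesis
      using assms(2) ev_mult[of fps_X "fps_deriv F" u] by (simp add: theta_D_def ev_def)
  qed
  ultimately show ?thesis by (simp add: ev_def[abs_def] mult.commute)
qed

lemma ev_tendsto_at_bot:
  assumes "unit_radius F"
  shows "(ev F \<longlongrightarrow> F $ 0) at_bot"
proof -
  have "ereal (norm (0::real)) < fps_conv_radius F"
    by (rule less_le_trans[OF _ assms]) (simp add: zero_ereal_def)
  then have "isCont (eval_fps F) 0" by (rule continuous_eval_fps)
  from isCont_tendsto_compose[OF this exp_at_bot]
  show ?thesis by (simp add: ev_def[abs_def] eval_fps_at_0)
qed

lemma ev_X_square: 
  assumes "unit_radius F" "u < 0"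
  shows "ev (F oo fps_X ^ 2) u = ev F (2 * u)"
proof -
  have "(\<lambda>n. F $ n * exp (2 * u) ^ n) sums ev F (2 * u)"
    using assms by (intro ev_sums) auto
  moreover have "(\<lambda>n. F $ n * exp (2 * u) ^ n) =
      (\<lambda>n. (F oo fps_X ^ 2) $ (2 * n) * exp u ^ (2 * n))"
    by (auto simp: fps_compose_X_square_nth power_mult exp_double)
  ultimately have "(\<lambda>n. (F oo fps_X ^ 2) $ (2 * n) * exp u ^ (2 * n)) sums ev F (2 * u)"
    by simp
  moreover have "(\<lambda>n. (F oo fps_X ^ 2) $ (2 * n) * exp u ^ (2 * n)) sums ev F (2 * u) \<longleftrightarrow>
      (\<lambda>n. (F oo fps_X ^ 2) $ n * exp u ^ n) sums ev F (2 * u)"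
  proof (rule sums_mono_reindex)
    show "strict_mono (\<lambda>n::nat. 2 * n)" by (simp add: strict_mono_def)
    show "(F oo fps_X ^ 2) $ n * exp u ^ n = 0" if "n \<notin> range (\<lambda>n. 2 * n)" for n
      using that by (auto simp: fps_compose_X_square_nth elim!: evenE)
  qed
  ultimately show ?thesis by (simp add: ev_def eval_fps_def sums_iff)
qed

lemma ev_theta4_sq_doubling: "u < 0 \<Longrightarrow> ev theta4_sq (2 * u) ^ 2 = ev theta3_sq u * ev theta4_sq u"
proof -
  assume u: "u < 0"
  have "ev theta4_sq (2 * u) ^ 2 = ev ((theta3_series oo - fps_X) * theta3_series) u ^ 2"
    using u by (simp add: ev_X_square theta4_sq_radius theta3_series_mult_T_uminus mult.commute[of _ theta3_series])
  also have "\<dots> = ev (theta3_sq * theta4_sq) u"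
    using u theta3_series_uminus_radius
    by (simp add: theta3_sq_def theta4_sq_def ev_mult ev_power unit_radius_intros power_mult_distrib mult.commute)
  finally show ?thesis using u by (simp add: ev_mult unit_radius_intros)
qed

section \<open>Signs and bounds for the theta functions at negative \<open>u\<close>\<close>

lemma ev_theta3_series_ge_1: "u < 0 \<Longrightarrow> ev theta3_series u \<ge> 1"
proof -
  assume u: "u < 0"
  have "(\<Sum>n\<in>{0}. theta3_series $ n * exp u ^ n) \<le> ev theta3_series u"
    using sum_le_suminf[of "\<lambda>n. theta3_series $ n * exp u ^ n" "{0}"] ev_sums[OF theta3_series_radius u]
    by (auto simp: theta3_series_nth sums_iff)
  then show ?thesis by (simp add: theta3_series_nth)
qed

lemma ev_theta3_sq: "u < 0 \<Longrightarrow> ev theta3_sq u = ev theta3_series u ^ 2"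
  by (simp add: theta3_sq_def ev_power theta3_series_radius)

lemma ev_theta3_sq_ge_1: "u < 0 \<Longrightarrow> ev theta3_sq u \<ge> 1"
  using ev_theta3_series_ge_1[of u] by (simp add: ev_theta3_sq one_le_power)

lemma ev_theta4_sq_nonneg: "u < 0 \<Longrightarrow> ev theta4_sq u \<ge> 0"
  by (simp add: theta4_sq_def ev_power theta3_series_uminus_radius)

lemma ev_theta4_sq_less: 
  assumes "u < 0"
  shows "ev theta4_sq u < ev theta3_sq u"
proof -
  have sums: "(\<lambda>n. theta3_sq $ n * exp u ^ n - theta4_sq $ n * exp u ^ n) sums (ev theta3_sq u - ev theta4_sq u)"
    using assms by (intro sums_diff ev_sums theta3_sq_radius theta4_sq_radius)
  have "theta4_sq $ n \<le> theta3_sq $ n" for n by (simp add: theta3_sq_nth theta4_sq_nth minus_one_power_iff)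
  then have "0 \<le> theta3_sq $ n * exp u ^ n - theta4_sq $ n * exp u ^ n" for n by (simp add: mult_right_mono)
  moreover have "0 < theta3_sq $ 1 * exp u ^ 1 - theta4_sq $ 1 * exp u ^ 1"
    unfolding theta3_sq_nth_1 theta4_sq_nth_1 by simp
  ultimately have "0 < (\<Sum>n. theta3_sq $ n * exp u ^ n - theta4_sq $ n * exp u ^ n)"
    using sums by (intro suminf_pos2[of _ 1]) (auto simp: sums_iff)
  then show ?thesis using sums by (simp add: sums_iff)
qed

lemma tendsto_ev_double_iterate:
  assumes "u < 0" "unit_radius F"
  shows "(\<lambda>n. ev F (2 ^ n * u)) \<longlonglongrightarrow> F $ 0"
proof -
  have "filterlim (\<lambda>n. (2::real) ^ n) at_top sequentially" by real_asymp
  then have "filterlim (\<lambda>n. 2 ^ n * u) at_bot sequentially"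
    using assms(1) by (subst mult.commute, intro filterlim_tendsto_neg_mult_at_bot[OF tendsto_const])
  then show ?thesis by (rule filterlim_compose[OF ev_tendsto_at_bot[OF assms(2)]])
qed

text \<open>By the doubling relation and \<open>ev_theta4_sq_less\<close>, the values at
  \<open>u\<close>, \<open>2 * u\<close>, \<open>4 * u\<close>, ... increase, and their limit is the
  constant term 1.\<close>

lemma ev_theta4_sq_le_1:
  assumes "u < 0"
  shows "ev theta4_sq u \<le> 1"
proof -
  have step: "ev theta4_sq v \<le> ev theta4_sq (2 * v)" if "v < 0" for v
  proof -
    have "ev theta4_sq v * ev theta4_sq v \<le> ev theta3_sq v * ev theta4_sq v"
      using that ev_theta4_sq_less[of v] ev_theta4_sq_nonneg[of v] by (intro mult_right_mono) auto
    then have "ev theta4_sq v ^ 2 \<le> ev theta4_sq (2 * v) ^ 2"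
      unfolding ev_theta4_sq_doubling[OF that] by (simp only: power2_eq_square)
    then show ?thesis using ev_theta4_sq_nonneg[of "2 * v"] that by (auto intro: power2_le_imp_le)
  qed
  have "ev theta4_sq u \<le> ev theta4_sq (2 ^ n * u)" for n
  proof (induction n)
    case (Suc n)
    then show ?case using step[of "2 ^ n * u"] assms by (simp add: mult.assoc mult_pos_neg)
  qed simp
  then show ?thesis
    using tendsto_ev_double_iterate[OF assms theta4_sq_radius] unfolding theta4_sq_nth_0
    by (intro LIMSEQ_le_const) auto
qed

text \<open>A zero at \<open>u\<close> would propagate by doubling to every
  \<open>2 ^ n * u\<close>, contradicting the limit 1 along that sequence.\<close>

lemma ev_theta4_sq_pos:
  assumes "u < 0"
  shows "ev theta4_sq u > 0"
proof (rule ccontr)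
  assume "\<not> ?thesis"
  then have "ev theta4_sq u = 0" using ev_theta4_sq_nonneg[OF assms] by simp
  then have "ev theta4_sq (2 ^ n * u) = 0" for n
  proof (induction n)
    case (Suc n)
    then show ?case using ev_theta4_sq_doubling[of "2 ^ n * u"] assms by (simp add: mult.assoc mult_pos_neg)
  qed simp
  then show False
    using tendsto_ev_double_iterate[OF assms theta4_sq_radius] unfolding theta4_sq_nth_0
    by (simp add: LIMSEQ_const_iff)
qed

section \<open>Growth of theta as \<open>u\<close> tends to 0, by comparison with a Gaussian
  integral\<close>

lemma ev_theta3_series_sums: 
  assumes "u < 0"
  shows "(\<lambda>n. exp (u * real n ^ 2)) sums ((ev theta3_series u + 1) / 2)"
proof -
  define F where "F k = (if k \<in> range (\<lambda>n::nat. n ^ 2) then exp u ^ k else 0)" for k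
  have "(\<lambda>k. (theta3_series $ k * exp u ^ k + (if k = 0 then 1 else 0)) / 2) sums ((ev theta3_series u + 1) / 2)"
    using sums_single[of 0 "\<lambda>_. 1::real"] assms
    by (intro sums_divide sums_add ev_sums theta3_series_radius) (auto simp: eq_commute)
  also have "(\<lambda>k. (theta3_series $ k * exp u ^ k + (if k = 0 then 1 else 0)) / 2) = F"
    by (auto simp: theta3_series_nth F_def fun_eq_iff intro: image_eqI[of _ _ "0::nat"])
  finally have "F sums ((ev theta3_series u + 1) / 2)" .
  moreover have "(\<lambda>n. F (n ^ 2)) sums ((ev theta3_series u + 1) / 2) \<longleftrightarrow> F sums ((ev theta3_series u + 1) / 2)"
    by (rule sums_mono_reindex) (auto simp: strict_mono_def F_def power_strict_mono)
  moreover have "(\<lambda>n. F (n ^ 2)) = (\<lambda>n. exp (u * real n ^ 2))"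
    by (auto simp: F_def fun_eq_iff mult.commute simp flip: exp_of_nat_mult)
  ultimately show ?thesis by simp
qed

lemma gaussian_integral_tendsto:
  assumes "c > 0"
  shows "(\<lambda>n. integral {0..real n} (\<lambda>t. exp (- (c * t)\<^sup>2))) \<longlonglongrightarrow> sqrt pi / (2 * c)"
proof -
  define g where "g = (\<lambda>t. indicator {0..} (0 + c * t) *\<^sub>R exp (- (0 + c * t)\<^sup>2) :: real)"
  have g: "has_bochner_integral lborel g (sqrt pi / (2 * c))"
    using lborel_has_bochner_integral_real_affine_iff[of c
        "\<lambda>t. indicator {0..} t *\<^sub>R exp (- t\<^sup>2) :: real" _ 0] gaussian_moment_0 assms
    by (simp add: g_def field_simps)
  have int: "integrable lborel g" using g by (simp add: has_bochner_integral_iff)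
  have "((\<lambda>y. \<integral>t. indicator {..y} t *\<^sub>R g t \<partial>lborel) \<longlongrightarrow> sqrt pi / (2 * c)) at_top"
    using tendsto_integral_at_top[OF _ int] g by (simp add: has_bochner_integral_iff)
  then have "(\<lambda>n. \<integral>t. indicator {..real n} t *\<^sub>R g t \<partial>lborel) \<longlonglongrightarrow> sqrt pi / (2 * c)"
    by (rule filterlim_compose) (rule filterlim_real_sequentially)
  moreover have "(\<integral>t. indicator {..real n} t *\<^sub>R g t \<partial>lborel) =
      integral {0..real n} (\<lambda>t. exp (- (c * t)\<^sup>2))" for n
  proof -
    have "integrable lborel (\<lambda>t. indicator {..real n} t *\<^sub>R g t)"
      using int by (intro integrable_mult_indicator) auto
    then have "(\<integral>t. indicator {..real n} t *\<^sub>R g t \<partial>lborel) =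
        integral UNIV (\<lambda>t. indicator {..real n} t *\<^sub>R g t)"
      by (rule integral_lborel[symmetric])
    also have "\<dots> = integral UNIV (\<lambda>t. if t \<in> {0..real n} then exp (- (c * t)\<^sup>2) else 0)"
      using assms by (intro arg_cong[of _ _ "integral UNIV"])
        (auto simp: g_def fun_eq_iff indicator_def zero_le_mult_iff)
    also have "\<dots> = integral {0..real n} (\<lambda>t. exp (- (c * t)\<^sup>2))"
      by (rule integral_restrict_UNIV)
    finally show ?thesis .
  qed
  ultimately show ?thesis by simp
qed

text \<open>Integral test for the decreasing function \<open>f\<close>: the sum over the naturals
  exceeds the integral over the half-line by an amount between 0 and \<open>f 0 = 1\<close>.\<close>

lemma ev_theta3_series_gaussian_bounds:
  assumes "u < 0"
  shows "\<bar>(ev theta3_series u + 1) / 2 - sqrt pi / (2 * sqrt (- u))\<bar> \<le> 1"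
proof -
  define c where "c = sqrt (- u)"
  have c: "c > 0" "c ^ 2 = - u" using assms by (simp_all add: c_def)
  define f where "f t = exp (- (c * t)\<^sup>2)" for t :: real
  interpret antimono_fun_sum_integral_diff f
  proof
    show "f y \<le> f x" if "0 \<le> x" "x \<le> y" for x y
      using that c(1) by (auto simp: f_def intro!: power_mono mult_left_mono)
  qed (auto simp: f_def intro!: continuous_intros)
  have lim: "sum_integral_diff_series \<longlonglongrightarrow> (ev theta3_series u + 1) / 2 - sqrt pi / (2 * c)"
    unfolding sum_integral_diff_series_def
  proof (rule tendsto_diff)
    have "(\<lambda>n. f (real n)) sums ((ev theta3_series u + 1) / 2)"
      using ev_theta3_series_sums[OF assms] c(2) by (simp add: f_def power_mult_distrib)
    then show "(\<lambda>n. \<Sum>k\<le>n. f (real k)) \<longlonglongrightarrow> (ev theta3_series u + 1) / 2" by (simp add: sums_def_le)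
    show "(\<lambda>n. integral {0..real n} f) \<longlonglongrightarrow> sqrt pi / (2 * c)"
      using gaussian_integral_tendsto[OF c(1)] by (simp add: f_def[abs_def])
  qed
  have "sum_integral_diff_series n \<le> 1" for n
    using sum_integral_diff_series_antimono[of 0 n]
    by (simp add: sum_integral_diff_series_def[of 0] f_def)
  then have "(ev theta3_series u + 1) / 2 - sqrt pi / (2 * c) \<le> 1"
    using lim by (intro LIMSEQ_le_const2) auto
  moreover have "0 \<le> (ev theta3_series u + 1) / 2 - sqrt pi / (2 * c)"
    using lim by (intro LIMSEQ_le_const) (auto simp: sum_integral_diff_series_nonneg)
  ultimately show ?thesis by (simp add: c_def)
qed

lemma ev_theta3_sq_asymp: "((\<lambda>u. - u / pi * ev theta3_sq u) \<longlongrightarrow> 1) (at_left 0)"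
proof -
  define h where "h u = sqrt (- u) / sqrt pi" for u
  have h: "(h \<longlongrightarrow> 0) (at_left 0)"
    unfolding h_def by (auto intro!: tendsto_eq_intros)
  have "((\<lambda>u. h u * ev theta3_series u) \<longlongrightarrow> 1) (at_left 0)"
  proof (rule tendsto_sandwich)
    have bounds: "\<bar>h u * ev theta3_series u - 1\<bar> \<le> 3 * h u" if "u < 0" for u
    proof -
      have hu: "h u > 0" "h u * (sqrt pi / sqrt (- u)) = 1" using that by (auto simp: h_def)
      \<comment> \<open>Doubling the bound 1 gives 2; the summand 1 in
        \<open>ev theta3_series u + 1\<close> adds the third unit.\<close>
      have "\<bar>ev theta3_series u - sqrt pi / sqrt (- u)\<bar> \<le> 3"
        using ev_theta3_series_gaussian_bounds[OF that] by (simp add: abs_le_iff field_simps)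
      then have "h u * \<bar>ev theta3_series u - sqrt pi / sqrt (- u)\<bar> \<le> h u * 3"
        using hu by (intro mult_left_mono) auto
      also have "h u * \<bar>ev theta3_series u - sqrt pi / sqrt (- u)\<bar> = \<bar>h u * ev theta3_series u - h u * (sqrt pi / sqrt (- u))\<bar>"
        using hu(1) unfolding right_diff_distrib[symmetric] abs_mult by simp
      finally show ?thesis using hu by simp
    qed
    show "\<forall>\<^sub>F u in at_left 0. 1 - 3 * h u \<le> h u * ev theta3_series u"
      by (rule eventually_at_leftI[of "-1"]) (use bounds in \<open>force simp: abs_le_iff\<close>)+
    show "\<forall>\<^sub>F u in at_left 0. h u * ev theta3_series u \<le> 1 + 3 * h u"
      by (rule eventually_at_leftI[of "-1"]) (use bounds in \<open>force simp: abs_le_iff\<close>)+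
  qed (use h in \<open>auto intro!: tendsto_eq_intros\<close>)
  then have "((\<lambda>u. (h u * ev theta3_series u) ^ 2) \<longlongrightarrow> 1 ^ 2) (at_left 0)" by (rule tendsto_power)
  moreover have "\<forall>\<^sub>F u in at_left 0. (h u * ev theta3_series u) ^ 2 = - u / pi * ev theta3_sq u"
    by (rule eventually_at_leftI[of "-1"]) (auto simp: h_def ev_theta3_sq power_mult_distrib power_divide)
  ultimately show ?thesis by (simp add: tendsto_cong)
qed

section \<open>The elliptic differential equation\<close>

lemma fps_conv_radius_ge_quarter:
  fixes F :: "real fps"
  assumes "\<And>n. 0 \<le> F $ n" "\<And>n. F $ Suc n \<le> 4 * F $ n"
  shows "fps_conv_radius F \<ge> 1/4"
  unfolding fps_conv_radius_def
proof (rule conv_radius_geI_ex)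
  fix r :: real assume r: "0 < r" "ereal r < 1/4"
  then have r': "r < 1/4" by (metis ereal_divide less_ereal.simps(1) one_ereal_def numeral_eq_ereal zero_neq_numeral)
  have bound: "F $ n \<le> F $ 0 * 4 ^ n" for n
  proof (induction n)
    case (Suc n)
    then show ?case using assms(2)[of n] by simp
  qed simp
  have "summable (\<lambda>n. F $ n * r ^ n)"
  proof (rule summable_comparison_test')
    show "summable (\<lambda>n. F $ 0 * (4 * r) ^ n)" using r r' by (intro summable_mult summable_geometric) auto
    show "norm (F $ n * r ^ n) \<le> F $ 0 * (4 * r) ^ n" for n
      using assms(1)[of n] bound[of n] r mult_right_mono[OF bound[of n], of "r ^ n"]
      by (simp add: power_mult_distrib mult.assoc)
  qed
  then show "\<exists>z. norm z = r \<and> summable (\<lambda>n. F $ n * z ^ n)" using r by (intro exI[of _ r]) auto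
qed

lemma hyp_even_radius: "fps_conv_radius hyp_even \<ge> 1/4"
proof (rule fps_conv_radius_ge_quarter)
  fix n
  have "(2 * real n + 1) * (2 * real n + 2) * hyp_even $ Suc n \<le> (2 * real n + 1) * (2 * real n + 2) * (4 * hyp_even $ n)"
    unfolding hyp_even_rec using hyp_even_pos[of n] by (simp add: algebra_simps power2_eq_square add_increasing)
  then show "hyp_even $ Suc n \<le> 4 * hyp_even $ n" by (rule mult_left_le_imp_le) (auto intro: mult_pos_pos)
qed (simp add: hyp_even_pos less_imp_le)

lemma hyp_odd_radius: "fps_conv_radius hyp_odd \<ge> 1/4"
proof (rule fps_conv_radius_ge_quarter)
  fix n
  have "(2 * real n + 2) * (2 * real n + 3) * hyp_odd $ Suc n \<le> (2 * real n + 2) * (2 * real n + 3) * (4 * hyp_odd $ n)"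
    unfolding hyp_odd_rec using hyp_odd_pos[of n] by (simp add: algebra_simps power2_eq_square add_increasing)
  then show "hyp_odd $ Suc n \<le> 4 * hyp_odd $ n" by (rule mult_left_le_imp_le) (auto intro: mult_pos_pos)
qed (simp add: hyp_odd_pos less_imp_le)

text \<open>$(\frac14 - s^2)f'' = 2sf' + \frac14 f$ is the equation of the complete elliptic integrals in the
  parameter $\lambda = \frac12 + s$; its even and odd solutions are \<open>ell_even\<close> and \<open>ell_odd\<close>.\<close>

definition ell_solution :: "(real \<Rightarrow> real) \<Rightarrow> bool" where
  "ell_solution f \<longleftrightarrow> (\<exists>f' f''. \<forall>s. \<bar>s\<bar> < 1/2 \<longrightarrow>
    (f has_real_derivative f' s) (at s) \<and> (f' has_real_derivative f'' s) (at s) \<and>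
    (1/4 - s ^ 2) * f'' s = 2 * s * f' s + f s / 4)"

definition ell_even :: "real \<Rightarrow> real" where "ell_even s = eval_fps hyp_even (s ^ 2)"
definition ell_odd :: "real \<Rightarrow> real" where "ell_odd s = s * eval_fps hyp_odd (s ^ 2)"

lemma square_less_quarter: "s ^ 2 < 1/4 \<longleftrightarrow> \<bar>s\<bar> < 1/2" for s :: real
  using abs_square_less_1[of "2 * s"] by (auto simp: power_mult_distrib)

lemma less_radius_quarter:
  fixes F :: "real fps" and s :: real
  assumes "fps_conv_radius F \<ge> 1/4" "\<bar>s\<bar> < 1/2"
  shows "ereal (norm (s ^ 2)) < fps_conv_radius F"
proof (rule less_le_trans[OF _ assms(1)])
  have "s ^ 2 < 1/4" using assms(2) square_less_quarter by blast
  then have "ereal (norm (s ^ 2)) < ereal (1/4)" by simp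
  then show "ereal (norm (s ^ 2)) < 1/4"
    by (metis ereal_divide numeral_eq_ereal one_ereal_def zero_neq_numeral)
qed

lemma eval_fps_square_deriv:
  fixes F :: "real fps"
  assumes "fps_conv_radius F \<ge> 1/4" "\<bar>s\<bar> < 1/2"
  shows "((\<lambda>s. eval_fps F (s ^ 2)) has_real_derivative 2 * s * eval_fps (fps_deriv F) (s ^ 2)) (at s)"
proof -
  have "(eval_fps F has_real_derivative eval_fps (fps_deriv F) (s ^ 2)) (at (s ^ 2))"
    using less_radius_quarter[OF assms] by (rule has_field_derivative_eval_fps)
  moreover have "((\<lambda>s. s ^ 2) has_real_derivative 2 * s) (at s)"
    by (auto intro!: derivative_eq_intros)
  ultimately show ?thesis
    using DERIV_chain2[where f = "eval_fps F" and g = "\<lambda>s. s ^ 2"] by (metis mult.commute)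
qed

lemma quarter_radius_deriv: "fps_conv_radius F \<ge> 1/4 \<Longrightarrow> fps_conv_radius (fps_deriv F) \<ge> 1/4"
  for F :: "real fps"
  by (rule order_trans[OF _ fps_conv_radius_deriv])

text \<open>The recurrence says that the differential operator annihilates \<open>F\<close>
  coefficientwise, which is \<open>R = 0\<close> in the proof. The parameters
  \<open>(p, q, k)\<close> are \<open>(2, 24, 1)\<close> for \<open>hyp_even\<close> and
  \<open>(6, 40, 9)\<close> for \<open>hyp_odd\<close>.\<close>

lemma eval_hypergeometric_ode:
  fixes F :: "real fps" and p q k :: real
  assumes rec: "\<And>n. (real n + 1) * (4 * real n + p) * F $ Suc n =
      (16 * real n ^ 2 + (q - 16) * real n + k) * F $ n"
    and radius: "fps_conv_radius F \<ge> 1/4" and s: "\<bar>s\<bar> < 1/2"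
  defines "t \<equiv> s ^ 2"
  shows "(p - q * t) * eval_fps (fps_deriv F) t + 4 * t * (1 - 4 * t) * eval_fps (fps_deriv (fps_deriv F)) t
    = k * eval_fps F t"
proof -
  let ?F1 = "fps_deriv F" and ?F2 = "fps_deriv (fps_deriv F)"
  have t: "ereal (norm t) < fps_conv_radius F" "ereal (norm t) < fps_conv_radius ?F1"
    "ereal (norm t) < fps_conv_radius ?F2"
    using radius s quarter_radius_deriv unfolding t_def by (blast intro: less_radius_quarter)+
  define R where "R = fps_const p * ?F1 - fps_const q * (fps_X * ?F1)
    + fps_const 4 * (fps_X * ?F2) - fps_const 16 * (fps_X * (fps_X * ?F2)) - fps_const k * F"
  have "R $ n = 0" for n
  proof (cases n)
    case 0
    then show ?thesis using rec[of 0] by (simp add: R_def)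
  next
    case (Suc m)
    then show ?thesis using rec[of n]
      by (cases m) (auto simp: R_def algebra_simps power2_eq_square)
  qed
  then have "R = 0" by (simp add: fps_eq_iff)
  moreover have "eval_fps R t = p * eval_fps ?F1 t - q * (t * eval_fps ?F1 t)
    + 4 * (t * eval_fps ?F2 t) - 16 * (t * (t * eval_fps ?F2 t)) - k * eval_fps F t"
  proof -
    have m: "ereal \<bar>t\<bar> < fps_conv_radius (G * G')" "ereal \<bar>t\<bar> < fps_conv_radius (G + G')"
      "ereal \<bar>t\<bar> < fps_conv_radius (G - G')"
      if "ereal \<bar>t\<bar> < fps_conv_radius G" "ereal \<bar>t\<bar> < fps_conv_radius G'" for G G' :: "real fps"
      using fps_conv_radius_mult[of G G'] fps_conv_radius_add[of G G'] fps_conv_radius_diff[of G G'] that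
      by (meson less_le_trans min_less_iff_conj)+
    show ?thesis
      unfolding R_def using t by (simp add: eval_fps_diff eval_fps_add eval_fps_mult m)
  qed
  ultimately show ?thesis by (simp add: algebra_simps)
qed

lemma ell_solution_even: "ell_solution ell_even"
  unfolding ell_solution_def
proof (intro exI allI impI conjI)
  let ?H1 = "fps_deriv hyp_even" and ?H2 = "fps_deriv (fps_deriv hyp_even)"
  fix s :: real assume s: "\<bar>s\<bar> < 1/2"
  have r: "fps_conv_radius ?H1 \<ge> 1/4" by (intro quarter_radius_deriv hyp_even_radius)
  show "(ell_even has_real_derivative 2 * s * eval_fps ?H1 (s ^ 2)) (at s)"
    unfolding ell_even_def using hyp_even_radius s by (rule eval_fps_square_deriv)
  show "((\<lambda>s. 2 * s * eval_fps ?H1 (s ^ 2)) has_real_derivative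
      2 * eval_fps ?H1 (s ^ 2) + 2 * s * (2 * s * eval_fps ?H2 (s ^ 2))) (at s)"
    by (rule derivative_eq_intros eval_fps_square_deriv[OF r s] refl)+ simp
  have "(2 - 24 * s ^ 2) * eval_fps ?H1 (s ^ 2) + 4 * s ^ 2 * (1 - 4 * s ^ 2) * eval_fps ?H2 (s ^ 2)
      = 1 * eval_fps hyp_even (s ^ 2)"
    using hyp_even_radius s
    by (intro eval_hypergeometric_ode) (use hyp_even_rec in \<open>simp_all add: algebra_simps power2_eq_square\<close>)
  then show "(1/4 - s ^ 2) * (2 * eval_fps ?H1 (s ^ 2) + 2 * s * (2 * s * eval_fps ?H2 (s ^ 2))) =
      2 * s * (2 * s * eval_fps ?H1 (s ^ 2)) + ell_even s / 4"
    unfolding ell_even_def by algebra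
qed

lemma ell_solution_odd: "ell_solution ell_odd"
  unfolding ell_solution_def
proof (intro exI allI impI conjI)
  let ?N1 = "fps_deriv hyp_odd" and ?N2 = "fps_deriv (fps_deriv hyp_odd)"
  fix s :: real assume s: "\<bar>s\<bar> < 1/2"
  have r: "fps_conv_radius ?N1 \<ge> 1/4" by (intro quarter_radius_deriv hyp_odd_radius)
  show "(ell_odd has_real_derivative eval_fps hyp_odd (s ^ 2) + s * (2 * s * eval_fps ?N1 (s ^ 2))) (at s)"
    unfolding ell_odd_def
    by (rule derivative_eq_intros eval_fps_square_deriv[OF hyp_odd_radius s] refl)+ simp
  show "((\<lambda>s. eval_fps hyp_odd (s ^ 2) + s * (2 * s * eval_fps ?N1 (s ^ 2))) has_real_derivative
      2 * s * eval_fps ?N1 (s ^ 2) + (2 * s * eval_fps ?N1 (s ^ 2) +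
        s * (2 * eval_fps ?N1 (s ^ 2) + 2 * s * (2 * s * eval_fps ?N2 (s ^ 2))))) (at s)"
    by (rule derivative_eq_intros eval_fps_square_deriv[OF r s] eval_fps_square_deriv[OF hyp_odd_radius s] refl)+ simp
  have "(6 - 40 * s ^ 2) * eval_fps ?N1 (s ^ 2) + 4 * s ^ 2 * (1 - 4 * s ^ 2) * eval_fps ?N2 (s ^ 2)
      = 9 * eval_fps hyp_odd (s ^ 2)"
    using hyp_odd_radius s
    by (intro eval_hypergeometric_ode) (use hyp_odd_rec in \<open>simp_all add: algebra_simps power2_eq_square\<close>)
  then have "s * ((6 - 40 * s ^ 2) * eval_fps ?N1 (s ^ 2) + 4 * s ^ 2 * (1 - 4 * s ^ 2) * eval_fps ?N2 (s ^ 2))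
      = s * (9 * eval_fps hyp_odd (s ^ 2))" by simp
  then show "(1/4 - s ^ 2) * (2 * s * eval_fps ?N1 (s ^ 2) + (2 * s * eval_fps ?N1 (s ^ 2) +
        s * (2 * eval_fps ?N1 (s ^ 2) + 2 * s * (2 * s * eval_fps ?N2 (s ^ 2))))) =
      2 * s * (eval_fps hyp_odd (s ^ 2) + s * (2 * s * eval_fps ?N1 (s ^ 2))) + ell_odd s / 4"
    unfolding ell_odd_def by algebra
qed

text \<open>\<open>\<lambda> - 1/2\<close>, where \<open>\<lambda> = (\<theta>\<^sub>2 / \<theta>\<^sub>3)\<^sup>4 = 1 - (\<theta>\<^sub>4 / \<theta>\<^sub>3)\<^sup>4\<close>.\<close>

definition lambda_shift :: "real \<Rightarrow> real" where "lambda_shift u = 1/2 - (ev theta4_sq u / ev theta3_sq u) ^ 2"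

lemma ev_theta3_sq_pos: "u < 0 \<Longrightarrow> ev theta3_sq u > 0"
  using ev_theta3_sq_ge_1[of u] by simp

lemma ev_theta2_pow4: "u < 0 \<Longrightarrow> ev theta2_pow4 u = ev theta3_sq u ^ 2 - ev theta4_sq u ^ 2"
  by (simp add: theta2_pow4_def ev_diff ev_power unit_radius_intros)

lemma ev_theta2_pow4_pos: "u < 0 \<Longrightarrow> ev theta2_pow4 u > 0"
  using ev_theta4_sq_less[of u] ev_theta4_sq_pos[of u] by (simp add: ev_theta2_pow4 power_strict_mono)

lemma abs_lambda_shift_less: "u < 0 \<Longrightarrow> \<bar>lambda_shift u\<bar> < 1/2"
proof -
  assume u: "u < 0"
  have "0 < ev theta4_sq u / ev theta3_sq u" "ev theta4_sq u / ev theta3_sq u < 1"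
    using u ev_theta4_sq_pos ev_theta3_sq_pos ev_theta4_sq_less by auto
  then have "0 < (ev theta4_sq u / ev theta3_sq u) ^ 2" "(ev theta4_sq u / ev theta3_sq u) ^ 2 < 1"
    by (auto simp: power_less_one_iff)
  then show ?thesis unfolding lambda_shift_def by linarith
qed

text \<open>The relations between power series, read in the variable \<open>u\<close>. By
  \<open>ev_theta2_pow4\<close> they form a closed first-order system for the two theta squares and
  the logarithmic derivative \<open>A'\<close>.\<close>

lemma ev_theta3_sq_log_deriv:
  assumes "u < 0"
  defines "A' \<equiv> \<lambda>u. ev (theta_D theta3_sq) u / ev theta3_sq u"
  shows "(ev theta3_sq has_real_derivative ev theta3_sq u * A' u) (at u)"
    and "(ev theta4_sq has_real_derivative ev theta4_sq u * (A' u - ev theta2_pow4 u / 2)) (at u)"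
    and "(A' has_real_derivative A' u ^ 2 + ev theta4_sq u ^ 2 * ev theta2_pow4 u / 4) (at u)"
proof -
  have a0: "ev theta3_sq u \<noteq> 0" using ev_theta3_sq_pos assms(1) by force
  show "(ev theta3_sq has_real_derivative ev theta3_sq u * A' u) (at u)"
    using ev_deriv[OF theta3_sq_radius assms(1)] a0 by (simp add: A'_def)
  have "ev (theta_D theta4_sq) u = ev theta4_sq u * (A' u - ev theta2_pow4 u / 2)"
  proof -
    have "ev (2 * (theta4_sq * theta_D theta3_sq - theta3_sq * theta_D theta4_sq)) u = ev (theta3_sq * theta4_sq * theta2_pow4) u"
      by (simp only: theta_wronskian)
    then have "2 * (ev theta4_sq u * ev (theta_D theta3_sq) u - ev theta3_sq u * ev (theta_D theta4_sq) u) = ev theta3_sq u * ev theta4_sq u * ev theta2_pow4 u"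
      using assms(1)
      by (simp add: ev_mult ev_diff ev_numeral unit_radius_intros)
    then show ?thesis using a0 by (simp add: A'_def field_simps)
  qed
  then show "(ev theta4_sq has_real_derivative ev theta4_sq u * (A' u - ev theta2_pow4 u / 2)) (at u)"
    using ev_deriv[OF theta4_sq_radius assms(1)] by simp
  let ?D2 = "theta_D (theta_D theta3_sq)"
  \<comment> \<open>The relation for \<open>theta3_sq_dlog\<close> is cleared of the quotient, so
    that \<open>ev\<close> is applied only to polynomials in series known to converge in the unit
    disc.\<close>
  have "4 * theta3_sq * ?D2 = 8 * theta_D theta3_sq ^ 2 + theta3_sq ^ 2 * theta4_sq ^ 2 * theta2_pow4"
  proof -
    have "?D2 = theta_D theta3_sq * theta3_sq_dlog + theta3_sq * theta_D theta3_sq_dlog" by (simp only: theta_D_theta3_sq theta_D_simps)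
    then show ?thesis using theta_D_theta3_sq_dlog theta_D_theta3_sq by algebra
  qed
  then have "ev (4 * theta3_sq * ?D2 - 8 * theta_D theta3_sq ^ 2) u = ev (theta3_sq ^ 2 * theta4_sq ^ 2 * theta2_pow4) u" by simp
  then have eq: "4 * ev theta3_sq u * ev ?D2 u - 8 * ev (theta_D theta3_sq) u ^ 2 = ev theta3_sq u ^ 2 * ev theta4_sq u ^ 2 * ev theta2_pow4 u"
    using assms(1) by (simp add: ev_mult ev_diff ev_power ev_numeral unit_radius_intros)
  have "(A' has_real_derivative (ev ?D2 u * ev theta3_sq u - ev (theta_D theta3_sq) u * ev (theta_D theta3_sq) u) / (ev theta3_sq u * ev theta3_sq u)) (at u)"
    unfolding A'_def using assms(1) a0 by (intro DERIV_divide ev_deriv unit_radius_intros)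
  moreover have "(ev ?D2 u * ev theta3_sq u - ev (theta_D theta3_sq) u * ev (theta_D theta3_sq) u) / (ev theta3_sq u * ev theta3_sq u)
      = A' u ^ 2 + ev theta4_sq u ^ 2 * ev theta2_pow4 u / 4"
    using eq a0 by (simp add: A'_def field_simps power2_eq_square)
  ultimately show "(A' has_real_derivative A' u ^ 2 + ev theta4_sq u ^ 2 * ev theta2_pow4 u / 4) (at u)" by simp
qed

lemma lambda_shift_deriv:
  assumes "u < 0"
  shows "(lambda_shift has_real_derivative ev theta4_sq u ^ 2 * ev theta2_pow4 u / ev theta3_sq u ^ 2) (at u)"
proof -
  have "ev theta3_sq u \<noteq> 0" using ev_theta3_sq_pos assms by force
  then show ?thesis
    unfolding lambda_shift_def
    by (auto intro!: derivative_eq_intros ev_theta3_sq_log_deriv[OF assms] simp: field_simps power2_eq_square)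
qed

lemma DERIV_zero_negative_reals:
  fixes f :: "real \<Rightarrow> real"
  assumes "\<And>u. u < 0 \<Longrightarrow> (f has_real_derivative 0) (at u)"
  obtains c where "\<And>u. u < 0 \<Longrightarrow> f u = c"
proof -
  have "\<exists>c. \<forall>u\<in>{..<0}. f u = c"
    by (rule has_field_derivative_zero_constant)
       (auto intro: has_field_derivative_at_within assms)
  then show ?thesis using that by auto
qed

text \<open>In the variable $u$ the equation becomes $(f/\theta_3^2)'' = 0$.\<close>

lemma ell_solution_linear:
  assumes "ell_solution f"
  obtains \<alpha> \<beta> where "\<And>u. u < 0 \<Longrightarrow> f (lambda_shift u) = ev theta3_sq u * (\<alpha> + \<beta> * u)"
proof -
  from assms obtain f' f'' where f: "\<And>s. \<bar>s\<bar> < 1/2 \<Longrightarrow> (f has_real_derivative f' s) (at s)"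
      "\<And>s. \<bar>s\<bar> < 1/2 \<Longrightarrow> (f' has_real_derivative f'' s) (at s)"
      "\<And>s. \<bar>s\<bar> < 1/2 \<Longrightarrow> (1/4 - s ^ 2) * f'' s = 2 * s * f' s + f s / 4"
    unfolding ell_solution_def by blast
  define A' where "A' = (\<lambda>u. ev (theta_D theta3_sq) u / ev theta3_sq u)"
  \<comment> \<open>The derivative of \<open>f (lambda_shift u) / ev theta3_sq u\<close>; the goal
    is that it is constant.\<close>
  define w1 where "w1 u = f' (lambda_shift u) * (ev theta4_sq u ^ 2 * (ev theta3_sq u ^ 2 - ev theta4_sq u ^ 2) / ev theta3_sq u ^ 3)
    - f (lambda_shift u) * (A' u / ev theta3_sq u)" for u
  have w: "((\<lambda>u. f (lambda_shift u) / ev theta3_sq u) has_real_derivative w1 u) (at u)"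
    and w1: "(w1 has_real_derivative 0) (at u)" if u: "u < 0" for u
  proof -
    have da: "(ev theta3_sq has_real_derivative ev theta3_sq u * A' u) (at u)"
      "(ev theta4_sq has_real_derivative ev theta4_sq u * (A' u - ev theta2_pow4 u / 2)) (at u)"
      "(A' has_real_derivative A' u ^ 2 + ev theta4_sq u ^ 2 * ev theta2_pow4 u / 4) (at u)"
      unfolding A'_def by (rule ev_theta3_sq_log_deriv[OF u])+
    have a0: "ev theta3_sq u \<noteq> 0" using ev_theta3_sq_pos u by force
    note df = DERIV_chain2[OF f(1)[OF abs_lambda_shift_less[OF u]] lambda_shift_deriv[OF u]]
      DERIV_chain2[OF f(2)[OF abs_lambda_shift_less[OF u]] lambda_shift_deriv[OF u]]
    show "((\<lambda>u. f (lambda_shift u) / ev theta3_sq u) has_real_derivative w1 u) (at u)"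
      by (rule DERIV_cong[OF DERIV_divide[OF df(1) da(1) a0]])
         (use a0 in \<open>simp add: w1_def ev_theta2_pow4[OF u] field_simps power2_eq_square power3_eq_cube\<close>)
    define x y z p q where "x = ev theta3_sq u" "y = ev theta4_sq u" "z = A' u" "p = f' (lambda_shift u)" "q = f'' (lambda_shift u)"
    note abbr = this
    have "(w1 has_real_derivative
        q * (y ^ 2 * (x ^ 2 - y ^ 2) / x ^ 2) * (y ^ 2 * (x ^ 2 - y ^ 2) / x ^ 3)
        + p * ((2 * y * (y * (z - (x ^ 2 - y ^ 2) / 2)) * (x ^ 2 - y ^ 2)
            + y ^ 2 * (2 * x * (x * z) - 2 * y * (y * (z - (x ^ 2 - y ^ 2) / 2)))) * x ^ 3
            - y ^ 2 * (x ^ 2 - y ^ 2) * (3 * x ^ 2 * (x * z))) / (x ^ 3 * x ^ 3)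
        - (p * (y ^ 2 * (x ^ 2 - y ^ 2) / x ^ 2) * (z / x)
          + f (lambda_shift u) * (((z ^ 2 + y ^ 2 * (x ^ 2 - y ^ 2) / 4) * x - z * (x * z)) / (x * x)))) (at u)"
      unfolding w1_def abbr
      by (rule derivative_eq_intros df da refl a0 power_not_zero | simp add: ev_theta2_pow4[OF u])+
         (simp add: mult_ac)
    \<comment> \<open>The equation for \<open>f\<close> with denominators cleared: at
      \<open>s = lambda_shift u\<close> the factor \<open>1/4 - s ^ 2\<close> equals
      \<open>y ^ 2 * (x ^ 2 - y ^ 2) / x ^ 4\<close>.\<close>
    moreover have h: "4 * (y ^ 2 * (x ^ 2 - y ^ 2)) * q = 4 * (x ^ 4 - 2 * x ^ 2 * y ^ 2) * p + x ^ 4 * f (lambda_shift u)"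
    proof -
      have "x ^ 4 * ((1/4 - (lambda_shift u) ^ 2) * q) = x ^ 4 * (2 * lambda_shift u * p + f (lambda_shift u) / 4)"
        using f(3)[OF abs_lambda_shift_less[OF u]] by (simp add: abbr)
      moreover have "lambda_shift u * (2 * x ^ 2) = x ^ 2 - 2 * y ^ 2"
        using a0 by (simp add: lambda_shift_def abbr field_simps)
      ultimately show ?thesis by algebra
    qed
    \<comment> \<open>All terms with \<open>z\<close> cancel, and the derivative of
      \<open>w1\<close> becomes a multiple of the defect in \<open>h\<close>.\<close>
    moreover have "q * (y ^ 2 * (x ^ 2 - y ^ 2) / x ^ 2) * (y ^ 2 * (x ^ 2 - y ^ 2) / x ^ 3)
        + p * ((2 * y * (y * (z - (x ^ 2 - y ^ 2) / 2)) * (x ^ 2 - y ^ 2)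
            + y ^ 2 * (2 * x * (x * z) - 2 * y * (y * (z - (x ^ 2 - y ^ 2) / 2)))) * x ^ 3
            - y ^ 2 * (x ^ 2 - y ^ 2) * (3 * x ^ 2 * (x * z))) / (x ^ 3 * x ^ 3)
        - (p * (y ^ 2 * (x ^ 2 - y ^ 2) / x ^ 2) * (z / x)
          + f (lambda_shift u) * (((z ^ 2 + y ^ 2 * (x ^ 2 - y ^ 2) / 4) * x - z * (x * z)) / (x * x)))
      = y ^ 2 * (x ^ 2 - y ^ 2) / (4 * x ^ 5) * (4 * (y ^ 2 * (x ^ 2 - y ^ 2)) * q
          - (4 * (x ^ 4 - 2 * x ^ 2 * y ^ 2) * p + x ^ 4 * f (lambda_shift u)))"
      using a0 unfolding abbr[symmetric] by (simp add: divide_simps) algebra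
    ultimately show "(w1 has_real_derivative 0) (at u)"
      by simp
  qed
  obtain \<beta> where \<beta>: "\<And>u. u < 0 \<Longrightarrow> w1 u = \<beta>"
    using DERIV_zero_negative_reals[of w1] w1 by blast
  have "((\<lambda>u. f (lambda_shift u) / ev theta3_sq u - \<beta> * u) has_real_derivative 0) (at u)" if "u < 0" for u
    using DERIV_diff[OF w[OF that] DERIV_cmult_Id[of \<beta>]] \<beta>[OF that] by simp
  then obtain \<alpha> where \<alpha>: "\<And>u. u < 0 \<Longrightarrow> f (lambda_shift u) / ev theta3_sq u - \<beta> * u = \<alpha>"
    using DERIV_zero_negative_reals[of "\<lambda>u. f (lambda_shift u) / ev theta3_sq u - \<beta> * u"] by blast
  have "f (lambda_shift u) = ev theta3_sq u * (\<alpha> + \<beta> * u)" if "u < 0" for u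
    using \<alpha>[OF that] ev_theta3_sq_pos[OF that] by (simp add: field_simps)
  then show ?thesis using that by blast
qed

section \<open>Boundary behaviour\<close>

text \<open>An Abelian argument: from some index on, \<open>G $ n\<close> is
  \<open>\<rho> * F $ n\<close> up to \<open>e / 2 * F $ n\<close>; the finitely many earlier terms
  contribute at most the constant \<open>C\<close>, negligible because \<open>eval_fps F\<close>
  tends to infinity.\<close>

lemma power_series_ratio_tendsto:
  fixes F G :: "real fps" and R :: real
  assumes R: "R > 0" "fps_conv_radius F \<ge> R" "fps_conv_radius G \<ge> R"
    and pos: "\<And>n. F $ n > 0" and ratio: "(\<lambda>n. G $ n / F $ n) \<longlonglongrightarrow> \<rho>"
    and lim: "filterlim (eval_fps F) at_top (at_left R)"
  shows "((\<lambda>t. eval_fps G t / eval_fps F t) \<longlongrightarrow> \<rho>) (at_left R)"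
proof (rule tendstoI)
  fix e :: real assume e: "e > 0"
  obtain n0 where n0: "\<And>n. n \<ge> n0 \<Longrightarrow> \<bar>G $ n / F $ n - \<rho>\<bar> < e / 2"
    using LIMSEQ_D[OF ratio, of "e / 2"] e by auto
  define d where "d n = G $ n - \<rho> * F $ n" for n
  define C where "C = (\<Sum>n<n0. \<bar>d n\<bar> * R ^ n)"
  have tail: "\<bar>d n\<bar> \<le> e / 2 * F $ n" if "n \<ge> n0" for n
  proof -
    have "\<bar>d n\<bar> = \<bar>G $ n / F $ n - \<rho>\<bar> * F $ n"
      using pos[of n] by (simp add: d_def field_simps abs_mult flip: abs_mult_pos)
    then show ?thesis using n0[OF that] pos[of n] by (simp add: mult_right_mono)
  qed
  have bound: "\<bar>eval_fps G t - \<rho> * eval_fps F t\<bar> \<le> C + e / 2 * eval_fps F t" if t: "0 < t" "t < R" for t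
  proof -
    have tr: "ereal (norm t) < fps_conv_radius F" "ereal (norm t) < fps_conv_radius G"
      using t R by (auto intro: less_le_trans[of _ "ereal R"])
    have sums: "(\<lambda>n. d n * t ^ n) sums (eval_fps G t - \<rho> * eval_fps F t)"
      unfolding d_def left_diff_distrib mult.assoc using tr by (intro sums_diff sums_mult sums_eval_fps)
    have sums2: "(\<lambda>n. (if n \<in> {..<n0} then \<bar>d n\<bar> * R ^ n else 0) + e / 2 * (F $ n * t ^ n)) sums
        (C + e / 2 * eval_fps F t)"
      unfolding C_def using tr by (intro sums_add sums_mult sums_eval_fps sums_If_finite_set) auto
    have bnd: "\<bar>d n * t ^ n\<bar> \<le> (if n \<in> {..<n0} then \<bar>d n\<bar> * R ^ n else 0) + e / 2 * (F $ n * t ^ n)" for n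
    proof (cases "n < n0")
      case True
      then have "\<bar>d n\<bar> * t ^ n \<le> \<bar>d n\<bar> * R ^ n" using t by (intro mult_left_mono power_mono) auto
      moreover have "0 \<le> e / 2 * (F $ n * t ^ n)" using e pos[of n] t by simp
      ultimately show ?thesis using True t by (simp add: abs_mult)
    next
      case False
      then have "\<bar>d n\<bar> * t ^ n \<le> e / 2 * F $ n * t ^ n" using t tail[of n] by (intro mult_right_mono) auto
      then show ?thesis using False t by (simp add: abs_mult)
    qed
    have "summable (\<lambda>n. \<bar>d n * t ^ n\<bar>)"
      by (rule summable_comparison_test'[OF sums_summable[OF sums2]]) (use bnd in auto)
    then have "\<bar>\<Sum>n. d n * t ^ n\<bar> \<le> (\<Sum>n. \<bar>d n * t ^ n\<bar>)" by (rule summable_rabs)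
    also have "\<dots> \<le> C + e / 2 * eval_fps F t"
      using suminf_le[OF bnd \<open>summable (\<lambda>n. \<bar>d n * t ^ n\<bar>)\<close> sums_summable[OF sums2]] sums2
      by (simp add: sums_iff)
    finally show ?thesis using sums by (simp add: sums_iff)
  qed
  have "eventually (\<lambda>t. eval_fps F t > 2 * \<bar>C\<bar> / e) (at_left R)"
    using lim unfolding filterlim_at_top_dense by blast
  moreover have "eventually (\<lambda>t. t \<in> {0<..<R}) (at_left R)"
    using R(1) by (rule eventually_at_left_real)
  ultimately show "eventually (\<lambda>t. dist (eval_fps G t / eval_fps F t) \<rho> < e) (at_left R)"
  proof eventually_elim
    case (elim t)
    have Fpos: "eval_fps F t > 0" using elim(1) e by (smt (verit) divide_nonneg_pos abs_ge_zero)
    have "\<bar>C\<bar> < e / 2 * eval_fps F t" using elim(1) e by (simp add: field_simps)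
    then have "\<bar>eval_fps G t - \<rho> * eval_fps F t\<bar> < e * eval_fps F t"
      using bound[of t] elim(2) by auto
    moreover have "eval_fps G t / eval_fps F t - \<rho> = (eval_fps G t - \<rho> * eval_fps F t) / eval_fps F t"
      using Fpos by (simp add: field_simps)
    ultimately show ?case using Fpos by (simp add: dist_real_def field_simps)
  qed
qed

text \<open>By the recurrence, \<open>n * hyp_even $ n * (1/4) ^ n\<close> is nondecreasing in
  \<open>n\<close>, and its value at \<open>n = 1\<close> is \<open>1/8\<close>.\<close>

lemma hyp_even_lower_bound: "n > 0 \<Longrightarrow> hyp_even $ n * (1/4) ^ n \<ge> 1 / (8 * real n)"
proof (induction n rule: nat_induct_non_zero)
  case 1
  show ?case using hyp_even_rec[of 0] by simp
next
  case (Suc n)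
  have "real n * hyp_even $ n * (8 * real n + 4) \<le> (4 * real n + 1) ^ 2 * hyp_even $ n / 2"
    using hyp_even_pos[of n] by (simp add: power2_eq_square algebra_simps)
  also have "\<dots> = (2 * real n + 1) * (real n + 1) * hyp_even $ Suc n"
    using hyp_even_rec[of n] by (simp add: algebra_simps)
  finally have "(2 * real n + 1) * (4 * (real n * hyp_even $ n)) \<le> (2 * real n + 1) * ((real n + 1) * hyp_even $ Suc n)"
    by (simp add: algebra_simps)
  then have "4 * (real n * hyp_even $ n) \<le> (real n + 1) * hyp_even $ Suc n"
    by (rule mult_left_le_imp_le) simp
  then have le: "4 * (real n * hyp_even $ n) * (1/4) ^ Suc n \<le> (real n + 1) * hyp_even $ Suc n * (1/4) ^ Suc n"
    by (intro mult_right_mono) auto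
  have "1 / 8 \<le> real n * (hyp_even $ n * (1/4) ^ n)" using Suc by (simp add: field_simps)
  also have "\<dots> = 4 * (real n * hyp_even $ n) * (1/4) ^ Suc n" by simp
  also note le
  finally show ?case by (simp add: field_simps)
qed

text \<open>The partial sums at \<open>t = 1/4\<close> dominate an eighth of the harmonic numbers;
  continuity of a single partial sum and positivity of the coefficients carry this over to smaller
  \<open>t\<close>.\<close>

lemma eval_hyp_even_at_top: "filterlim (eval_fps hyp_even) at_top (at_left (1/4))"
  unfolding filterlim_at_top_dense
proof
  fix Z :: real
  have "eventually (\<lambda>m. harm m > 8 * Z) sequentially"
    using harm_at_top unfolding filterlim_at_top_dense by blast
  then obtain m where m: "harm m > 8 * Z" unfolding eventually_sequentially by blast
  define P where "P t = (\<Sum>n\<le>m. hyp_even $ n * t ^ n)" for t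
  have "Z < harm m / 8" using m by simp
  also have "\<dots> = (\<Sum>n=1..m. 1 / (8 * real n))"
    by (simp add: harm_def sum_divide_distrib field_simps)
  also have "\<dots> \<le> (\<Sum>n=1..m. hyp_even $ n * (1/4) ^ n)"
    by (intro sum_mono hyp_even_lower_bound) auto
  also have "\<dots> \<le> P (1/4)"
    unfolding P_def by (intro sum_mono2) (auto simp: hyp_even_pos less_imp_le)
  finally have "Z < P (1/4)" .
  moreover have "(P \<longlongrightarrow> P (1/4)) (at_left (1/4))"
    unfolding P_def by (intro tendsto_intros)
  ultimately have "eventually (\<lambda>t. Z < P t) (at_left (1/4))" by (rule order_tendstoD(1)[rotated])
  moreover have "eventually (\<lambda>t. t \<in> {0<..<1/4::real}) (at_left (1/4))"
    by (rule eventually_at_left_real) simp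
  ultimately show "eventually (\<lambda>t. Z < eval_fps hyp_even t) (at_left (1/4))"
  proof eventually_elim
    case (elim t)
    have "ereal (norm t) < ereal (1/4)" using elim(2) by simp
    also have "ereal (1/4) \<le> fps_conv_radius hyp_even" using hyp_even_radius by (simp add: one_ereal_def numeral_eq_ereal)
    finally have "(\<lambda>n. hyp_even $ n * t ^ n) sums eval_fps hyp_even t" by (rule sums_eval_fps)
    then have "P t \<le> eval_fps hyp_even t"
      unfolding P_def using elim(2) sum_le_suminf[of "\<lambda>n. hyp_even $ n * t ^ n" "{..m}"]
      by (auto simp: sums_iff hyp_even_pos less_imp_le)
    then show ?case using elim(1) by simp
  qed
qed

text \<open>The limit of the coefficient ratio of \<open>hyp_odd\<close> and
  \<open>hyp_even\<close>; consequently \<open>ell_odd / ell_even\<close> tends to plus or minus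
  half of it at the two ends of the interval.\<close>

definition ell_ratio :: real where "ell_ratio = Gamma (1/4) ^ 2 / (2 * Gamma (3/4) ^ 2)"

lemma hyp_coeff_ratio_tendsto: "(\<lambda>n. hyp_odd $ n / hyp_even $ n) \<longlonglongrightarrow> ell_ratio"
proof -
  let ?g = "\<lambda>z::real. Gamma_series' z"
  have pos: "Gamma (z::real) \<noteq> 0" if "z > 0" for z using Gamma_real_pos[OF that] by simp
  have "(\<lambda>n. ?g (3/2) n * ?g (1/4) n ^ 2 / (?g (3/4) n ^ 2 * ?g (1/2) n)) \<longlonglongrightarrow>
      Gamma (3/2) * Gamma (1/4) ^ 2 / (Gamma (3/4) ^ 2 * Gamma (1/2))"
    by (intro tendsto_intros Gamma_series'_LIMSEQ) (simp add: pos)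
  moreover have "eventually (\<lambda>n. ?g (3/2) n * ?g (1/4) n ^ 2 / (?g (3/4) n ^ 2 * ?g (1/2) n) = hyp_odd $ n / hyp_even $ n)
      sequentially"
    using eventually_gt_at_top[of 0]
  proof eventually_elim
    case (elim n)
    define L where "L = ln (real n)"
    have p: "pochhammer (z::real) n > 0" if "z > 0" for z using that by (rule pochhammer_pos)
    \<comment> \<open>The powers of \<open>n\<close> in the Gamma limits cancel because
      \<open>3/2 + 2 * (1/4) = 2 * (3/4) + 1/2\<close>.\<close>
    have e: "exp (3/2 * L) * exp (1/4 * L) ^ 2 = exp (3/4 * L) ^ 2 * exp (1/2 * L)"
      by (simp add: power2_eq_square mult_exp_exp)
    have "?g (3/2) n * ?g (1/4) n ^ 2 / (?g (3/4) n ^ 2 * ?g (1/2) n) =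
      (exp (3/2 * L) * exp (1/4 * L) ^ 2) / (exp (3/4 * L) ^ 2 * exp (1/2 * L)) *
      (pochhammer (3/4) n ^ 2 * pochhammer (1/2) n / (pochhammer (3/2) n * pochhammer (1/4) n ^ 2))"
      using p[of "3/2"] p[of "1/4"] p[of "3/4"] p[of "1/2"]
      by (simp add: Gamma_series'_def field_simps flip: L_def)
    also have "\<dots> = pochhammer (3/4) n ^ 2 * pochhammer (1/2) n / (pochhammer (3/2) n * pochhammer (1/4) n ^ 2)"
      unfolding e by simp
    also have "\<dots> = hyp_odd $ n / hyp_even $ n"
      using p[of "3/2"] p[of "1/4"] p[of "3/4"] p[of "1/2"]
      by (simp add: fps_hypergeo_nth field_simps power2_eq_square)
    finally show ?case .
  qed
  moreover have "Gamma (3/2) = Gamma (1/2) / (2::real)"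
    using Gamma_plus1[of "1/2::real"] nonpos_Ints_nonpos[of "1/2::real"] by fastforce
  ultimately show ?thesis
    using pos[of "1/2"] by (simp add: ell_ratio_def tendsto_cong mult_ac)
qed

lemma hyp_ratio_tendsto: "((\<lambda>t. eval_fps hyp_odd t / eval_fps hyp_even t) \<longlongrightarrow> ell_ratio) (at_left (1/4))"
  using hyp_even_radius hyp_odd_radius
  by (intro power_series_ratio_tendsto hyp_even_pos hyp_coeff_ratio_tendsto eval_hyp_even_at_top)
     (simp_all add: one_ereal_def numeral_eq_ereal)

lemma Gamma_quarter_reflection: "Gamma (1/4) * Gamma (3/4) = (sqrt 2 * pi :: real)"
proof -
  have "complex_of_real (Gamma (1/4) * Gamma (3/4)) = Gamma (1/4) * Gamma (1 - 1/4)"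
    using Gamma_complex_of_real[of "1/4"] Gamma_complex_of_real[of "3/4"] by simp
  also have "\<dots> = complex_of_real (pi / sin (pi / 4))"
    by (subst Gamma_reflection_complex) (simp add: flip: sin_of_real)
  finally have "Gamma (1/4) * Gamma (3/4) = pi / sin (pi / 4)" by (simp only: of_real_eq_iff)
  then have "sqrt 2 * (Gamma (1/4) * Gamma (3/4)) = 2 * pi" by (simp add: sin_45 field_simps)
  moreover have "sqrt 2 * sqrt 2 = (2::real)" by simp
  ultimately show ?thesis by algebra
qed

text \<open>The reflection formula eliminates \<open>Gamma (3/4)\<close> and gives
  \<open>ell_ratio = Gamma (1/4) ^ 4 / (4 * pi ^ 2)\<close>.\<close>

lemma ell_ratio_Phi: "8 * Phi = ell_ratio ^ 2"
proof -
  have "Gamma (1/4::real) > 0" by (rule Gamma_real_pos) simp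
  then have pos: "Gamma (1/4::real) \<noteq> 0" by linarith
  have "Gamma (3/4) = sqrt 2 * pi / Gamma (1/4::real)"
    using Gamma_quarter_reflection pos by (simp add: field_simps)
  then have "Gamma (3/4::real) ^ 2 = 2 * pi ^ 2 / Gamma (1/4) ^ 2"
    by (simp add: power_divide power_mult_distrib)
  then have "ell_ratio = Gamma (1/4) ^ 2 / (2 * (2 * pi ^ 2 / Gamma (1/4) ^ 2))"
    by (simp only: ell_ratio_def)
  then have "ell_ratio = Gamma (1/4) ^ 4 / (4 * pi ^ 2)"
    by (simp add: power2_eq_square power4_eq_xxxx mult_ac)
  then have "ell_ratio ^ 2 = (Gamma (1/4) ^ 4 / (4 * pi ^ 2)) ^ 2" by (simp only:)
  then show ?thesis by (simp add: Phi_def power_divide power_mult_distrib flip: power_mult)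
qed

lemma ell_ratio_pos: "ell_ratio > 0"
  unfolding ell_ratio_def
  by (intro divide_pos_pos mult_pos_pos zero_less_power Gamma_real_pos) simp_all

section \<open>\<open>lambda_shift\<close> as a bijection and its limits at the two ends\<close>

lemma lambda_shift_at_bot: "(lambda_shift \<longlongrightarrow> -1/2) at_bot"
  unfolding lambda_shift_def
  using ev_tendsto_at_bot[OF theta3_sq_radius] ev_tendsto_at_bot[OF theta4_sq_radius]
  by (auto intro!: tendsto_eq_intros simp: theta3_sq_nth_0 theta4_sq_nth_0)

lemma inverse_ev_theta3_sq_tendsto: "((\<lambda>u. 1 / ev theta3_sq u) \<longlongrightarrow> 0) (at_left 0)"
proof -
  have "((\<lambda>u. - u / pi) \<longlongrightarrow> 0) (at_left 0)" by (auto intro!: tendsto_eq_intros)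
  then have "((\<lambda>u. (- u / pi) / (- u / pi * ev theta3_sq u)) \<longlongrightarrow> 0 / 1) (at_left 0)"
    by (rule tendsto_divide[OF _ ev_theta3_sq_asymp]) simp
  moreover have "eventually (\<lambda>u. (- u / pi) / (- u / pi * ev theta3_sq u) = 1 / ev theta3_sq u) (at_left 0)"
    by (rule eventually_at_leftI[of "-1"]) auto
  ultimately have "((\<lambda>u. 1 / ev theta3_sq u) \<longlongrightarrow> 0 / 1) (at_left 0)" by (rule Lim_transform_eventually)
  then show ?thesis by simp
qed

text \<open>As \<open>u\<close> tends to 0, \<open>ev theta4_sq\<close> stays at most 1 while
  \<open>ev theta3_sq\<close> grows without bound.\<close>

lemma lambda_shift_at_left_0: "(lambda_shift \<longlongrightarrow> 1/2) (at_left 0)"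
proof -
  have "((\<lambda>u. ev theta4_sq u / ev theta3_sq u) \<longlongrightarrow> 0) (at_left 0)"
  proof (rule tendsto_sandwich[OF _ _ tendsto_const inverse_ev_theta3_sq_tendsto])
    show "\<forall>\<^sub>F u in at_left 0. 0 \<le> ev theta4_sq u / ev theta3_sq u"
      by (rule eventually_at_leftI[of "-1"]) (auto intro!: divide_nonneg_pos simp: ev_theta4_sq_nonneg ev_theta3_sq_pos)
    show "\<forall>\<^sub>F u in at_left 0. ev theta4_sq u / ev theta3_sq u \<le> 1 / ev theta3_sq u"
      by (rule eventually_at_leftI[of "-1"]) (auto intro!: divide_right_mono simp: ev_theta4_sq_le_1 ev_theta3_sq_pos less_imp_le)
  qed
  then have "((\<lambda>u. 1/2 - (ev theta4_sq u / ev theta3_sq u) ^ 2) \<longlongrightarrow> 1/2 - 0 ^ 2) (at_left 0)"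
    by (intro tendsto_intros)
  then show ?thesis by (simp add: lambda_shift_def[abs_def])
qed

lemma lambda_shift_strict_mono:
  assumes "x < y" "y < 0"
  shows "lambda_shift x < lambda_shift y"
proof (rule DERIV_pos_imp_increasing[OF assms(1)])
  fix u assume "x \<le> u" "u \<le> y"
  then have u: "u < 0" using assms by simp
  then have "ev theta4_sq u ^ 2 * ev theta2_pow4 u / ev theta3_sq u ^ 2 > 0"
    by (intro divide_pos_pos mult_pos_pos zero_less_power ev_theta4_sq_pos ev_theta2_pow4_pos ev_theta3_sq_pos)
  then show "\<exists>d. DERIV lambda_shift u :> d \<and> d > 0" using lambda_shift_deriv[OF u] by blast
qed

lemma lambda_shift_surj:
  assumes "\<bar>s\<bar> < 1/2"
  obtains u where "u < 0" "lambda_shift u = s"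
proof -
  have "eventually (\<lambda>u. s < lambda_shift u) (at_left 0)"
    using assms by (intro order_tendstoD(1)[OF lambda_shift_at_left_0]) auto
  then obtain y where y: "y < 0" "\<And>u. y < u \<Longrightarrow> u < 0 \<Longrightarrow> s < lambda_shift u"
    unfolding eventually_at_left_field by (metis)
  define p where "p = y / 2"
  have p: "p < 0" "s < lambda_shift p" using y by (auto simp: p_def)
  have "eventually (\<lambda>u. lambda_shift u < s) at_bot"
    using assms by (intro order_tendstoD(2)[OF lambda_shift_at_bot]) auto
  then obtain x where x: "\<And>u. u \<le> x \<Longrightarrow> lambda_shift u < s" unfolding eventually_at_bot_linorder by blast
  define q where "q = min x p"
  have "lambda_shift q < s" "q \<le> p" using x by (auto simp: q_def)
  have "\<exists>u\<ge>q. u \<le> p \<and> lambda_shift u = s"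
  proof (rule IVT)
    show "\<forall>u. q \<le> u \<and> u \<le> p \<longrightarrow> isCont lambda_shift u"
      using p(1) DERIV_isCont[OF lambda_shift_deriv] by auto
  qed (use \<open>lambda_shift q < s\<close> \<open>q \<le> p\<close> p in auto)
  then show ?thesis using that p(1) by (metis le_less_trans)
qed

lemma lambda_shift_square_at_left:
  assumes "F = at_bot \<or> F = at_left 0"
  shows "filterlim (\<lambda>u. lambda_shift u ^ 2) (at_left (1/4)) F"
proof (rule tendsto_imp_filterlim_at_left)
  have "((\<lambda>u. lambda_shift u ^ 2) \<longlongrightarrow> (-1/2) ^ 2) at_bot" "((\<lambda>u. lambda_shift u ^ 2) \<longlongrightarrow> (1/2) ^ 2) (at_left 0)"
    by (intro tendsto_intros lambda_shift_at_bot lambda_shift_at_left_0)+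
  then show "((\<lambda>u. lambda_shift u ^ 2) \<longlongrightarrow> 1/4) F"
    using assms by (auto simp: power2_eq_square)
  have "eventually (\<lambda>u::real. u < 0) at_bot" "eventually (\<lambda>u::real. u < 0) (at_left 0)"
    by (rule eventually_gt_at_bot, simp add: eventually_at_filter)
  then have "eventually (\<lambda>u. u < 0) F" using assms by blast
  then show "eventually (\<lambda>u. lambda_shift u ^ 2 < 1/4) F"
    by eventually_elim (use abs_lambda_shift_less square_less_quarter in blast)
qed

lemma ell_even_lambda_shift_at_top:
  assumes "F = at_bot \<or> F = at_left 0"
  shows "filterlim (\<lambda>u. ell_even (lambda_shift u)) at_top F"
  unfolding ell_even_def by (rule filterlim_compose[OF eval_hyp_even_at_top lambda_shift_square_at_left[OF assms]])

lemma ell_odd_over_even_lambda_shift: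
  assumes "F = at_bot \<or> F = at_left 0" "(lambda_shift \<longlongrightarrow> m) F"
  shows "((\<lambda>u. ell_odd (lambda_shift u) / ell_even (lambda_shift u)) \<longlongrightarrow> m * ell_ratio) F"
  using tendsto_mult[OF assms(2) filterlim_compose[OF hyp_ratio_tendsto lambda_shift_square_at_left[OF assms(1)]]]
  by (simp add: ell_even_def ell_odd_def)

lemma ell_even_minus: "ell_even (- s) = ell_even s"
  and ell_odd_minus: "ell_odd (- s) = - ell_odd s"
  by (simp_all add: ell_even_def ell_odd_def)

text \<open>\<open>ell_even \<plusminus> (2 / ell_ratio) * ell_odd\<close> are, up to a common factor, the elliptic integrals
  $K$ and $K'$: each has only one logarithmic singularity.\<close>

lemma elliptic_combination_eq_theta:
  assumes "u < 0"
  shows "ell_even (lambda_shift u) + 2 / ell_ratio * ell_odd (lambda_shift u) = ev theta3_sq u / ev theta3_sq (- pi)"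
    and "ell_even (lambda_shift u) - 2 / ell_ratio * ell_odd (lambda_shift u) = - u / pi * ev theta3_sq u / ev theta3_sq (- pi)"
proof -
  obtain \<alpha> \<beta> where even: "\<And>u. u < 0 \<Longrightarrow> ell_even (lambda_shift u) = ev theta3_sq u * (\<alpha> + \<beta> * u)"
    using ell_solution_linear[OF ell_solution_even] by blast
  obtain \<gamma> \<delta> where odd: "\<And>u. u < 0 \<Longrightarrow> ell_odd (lambda_shift u) = ev theta3_sq u * (\<gamma> + \<delta> * u)"
    using ell_solution_linear[OF ell_solution_odd] by blast
  have neg_bot: "eventually (\<lambda>u::real. u < 0) at_bot" and neg_0: "eventually (\<lambda>u::real. u < 0) (at_left 0)"
    by (rule eventually_gt_at_bot, simp add: eventually_at_filter)
  have quot: "ell_odd (lambda_shift u) / ell_even (lambda_shift u) = (\<gamma> + \<delta> * u) / (\<alpha> + \<beta> * u)" if "u < 0" for u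
    using even[OF that] odd[OF that] ev_theta3_sq_pos[OF that] by simp
  have quot_bot: "eventually (\<lambda>u. ell_odd (lambda_shift u) / ell_even (lambda_shift u) = (\<gamma> + \<delta> * u) / (\<alpha> + \<beta> * u)) at_bot"
    using neg_bot by eventually_elim (rule quot)
  have quot_0: "eventually (\<lambda>u. ell_odd (lambda_shift u) / ell_even (lambda_shift u) = (\<gamma> + \<delta> * u) / (\<alpha> + \<beta> * u)) (at_left 0)"
    using neg_0 by eventually_elim (rule quot)
  \<comment> \<open>\<open>ell_even\<close> diverges at both ends, whereas
    \<open>\<beta> = 0\<close> would make it converge at minus infinity and
    \<open>\<alpha> = 0\<close> would make it converge at 0.\<close>
  have "\<beta> \<noteq> 0"
  proof
    assume "\<beta> = 0"
    have "eventually (\<lambda>u. ev theta3_sq u * \<alpha> = ell_even (lambda_shift u)) at_bot"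
      using neg_bot by eventually_elim (simp add: even \<open>\<beta> = 0\<close>)
    moreover have "((\<lambda>u. ev theta3_sq u * \<alpha>) \<longlongrightarrow> theta3_sq $ 0 * \<alpha>) at_bot"
      by (intro tendsto_intros ev_tendsto_at_bot theta3_sq_radius)
    ultimately have "((\<lambda>u. ell_even (lambda_shift u)) \<longlongrightarrow> theta3_sq $ 0 * \<alpha>) at_bot"
      by (rule Lim_transform_eventually[rotated])
    then show False using ell_even_lambda_shift_at_top[of at_bot]
      by (auto dest: not_tendsto_and_filterlim_at_infinity[rotated] filterlim_at_top_imp_at_infinity)
  qed
  have "\<alpha> \<noteq> 0"
  proof
    assume "\<alpha> = 0"
    have "eventually (\<lambda>u. (- u / pi * ev theta3_sq u) * (- pi * \<beta>) = ell_even (lambda_shift u)) (at_left 0)"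
      using neg_0 by eventually_elim (simp add: even \<open>\<alpha> = 0\<close>)
    moreover have "((\<lambda>u. (- u / pi * ev theta3_sq u) * (- pi * \<beta>)) \<longlongrightarrow> 1 * (- pi * \<beta>)) (at_left 0)"
      by (intro tendsto_intros ev_theta3_sq_asymp)
    ultimately have "((\<lambda>u. ell_even (lambda_shift u)) \<longlongrightarrow> 1 * (- pi * \<beta>)) (at_left 0)"
      by (rule Lim_transform_eventually[rotated])
    then show False using ell_even_lambda_shift_at_top[of "at_left 0"]
      by (auto dest: not_tendsto_and_filterlim_at_infinity[rotated] filterlim_at_top_imp_at_infinity)
  qed
  \<comment> \<open>The quotient of odd by even solution is a fractional linear function of
    \<open>u\<close>. Its limit at minus infinity determines \<open>\<delta>\<close>, and its limit
    at 0 determines \<open>\<gamma>\<close>.\<close>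
  have \<delta>: "\<delta> = - ell_ratio / 2 * \<beta>"
  proof -
    have "((\<lambda>u. (\<gamma> + \<delta> * u) / (\<alpha> + \<beta> * u)) \<longlongrightarrow> -1/2 * ell_ratio) at_bot"
      by (rule Lim_transform_eventually[OF ell_odd_over_even_lambda_shift[OF _ lambda_shift_at_bot] quot_bot]) simp
    moreover have "((\<lambda>u. (\<gamma> + \<delta> * u) / (\<alpha> + \<beta> * u)) \<longlongrightarrow> \<delta> * inverse \<beta>) at_bot"
      using \<open>\<beta> \<noteq> 0\<close> by real_asymp
    ultimately have "-1/2 * ell_ratio = \<delta> * inverse \<beta>" by (rule tendsto_unique[rotated]) simp
    then show ?thesis using \<open>\<beta> \<noteq> 0\<close> by (simp add: field_simps)
  qed
  have \<gamma>: "\<gamma> = ell_ratio / 2 * \<alpha>"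
  proof -
    have "((\<lambda>u. (\<gamma> + \<delta> * u) / (\<alpha> + \<beta> * u)) \<longlongrightarrow> 1/2 * ell_ratio) (at_left 0)"
      by (rule Lim_transform_eventually[OF ell_odd_over_even_lambda_shift[OF _ lambda_shift_at_left_0] quot_0]) simp
    moreover have "((\<lambda>u. (\<gamma> + \<delta> * u) / (\<alpha> + \<beta> * u)) \<longlongrightarrow> (\<gamma> + \<delta> * 0) / (\<alpha> + \<beta> * 0)) (at_left 0)"
      using \<open>\<alpha> \<noteq> 0\<close> by (intro tendsto_intros) auto
    ultimately have "1/2 * ell_ratio = (\<gamma> + \<delta> * 0) / (\<alpha> + \<beta> * 0)"
      by (rule tendsto_unique[rotated]) simp
    then show ?thesis using \<open>\<alpha> \<noteq> 0\<close> by (simp add: field_simps)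
  qed
  \<comment> \<open>With these constants \<open>\<phi>\<close> picks out the part without
    \<open>u\<close>, and its reflection the part proportional to \<open>u\<close>.\<close>
  define \<phi> where "\<phi> s = ell_even s + 2 / ell_ratio * ell_odd s" for s
  have plus: "\<phi> (lambda_shift u) = 2 * \<alpha> * ev theta3_sq u" and minus: "\<phi> (- lambda_shift u) = 2 * \<beta> * u * ev theta3_sq u" if "u < 0" for u
    using ell_ratio_pos
    by (simp_all add: \<phi>_def ell_even_minus ell_odd_minus even[OF that] odd[OF that] \<gamma> \<delta> field_simps)
  \<comment> \<open>To relate \<open>\<alpha>\<close> and \<open>\<beta>\<close>, points
    \<open>p n\<close> tending to minus infinity are paired with points \<open>w n\<close> of
    opposite \<open>lambda_shift\<close>. Both formulas for \<open>\<phi>\<close> have known limits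
    along the pair.\<close>
  define p where "p n = - real (Suc n)" for n
  have p: "p n < 0" for n by (simp add: p_def)
  have p_lim: "filterlim p at_bot sequentially" unfolding p_def by real_asymp
  have "\<exists>u<0. lambda_shift u = - lambda_shift (p n)" for n
    using lambda_shift_surj[of "- lambda_shift (p n)"] abs_lambda_shift_less[OF p] by (metis abs_minus_cancel)
  then obtain w where w: "\<And>n. w n < 0" "\<And>n. lambda_shift (w n) = - lambda_shift (p n)" by metis
  have lambda_shift_w: "(\<lambda>n. lambda_shift (w n)) \<longlonglongrightarrow> 1/2"
    using tendsto_minus[OF filterlim_compose[OF lambda_shift_at_bot p_lim]] by (simp add: w)
  \<comment> \<open>Strict monotonicity converts the limit \<open>1/2\<close> of
    \<open>lambda_shift (w n)\<close> into the limit 0 of \<open>w n\<close>.\<close>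
  have w_lim: "filterlim w (at_left 0) sequentially"
  proof (rule tendsto_imp_filterlim_at_left[OF order_tendstoI])
    fix y :: real assume "y < 0"
    then have "eventually (\<lambda>n. lambda_shift y < lambda_shift (w n)) sequentially"
      using abs_lambda_shift_less[of y] by (intro order_tendstoD(1)[OF lambda_shift_w]) linarith
    then show "eventually (\<lambda>n. y < w n) sequentially"
      by eventually_elim (use lambda_shift_strict_mono w(1) \<open>y < 0\<close> in \<open>metis not_less_iff_gr_or_eq\<close>)
  next
    fix y :: real assume "0 < y"
    then show "eventually (\<lambda>n. w n < y) sequentially"
      using w(1) by (intro always_eventually) (auto intro: less_trans)
  qed (use w(1) in simp)
  have "2 * \<alpha> * ev theta3_sq (p n) = - 2 * \<beta> * pi * (- w n / pi * ev theta3_sq (w n))" for n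
  proof -
    have "2 * \<alpha> * ev theta3_sq (p n) = \<phi> (lambda_shift (p n))" by (rule plus[OF p, symmetric])
    also have "lambda_shift (p n) = - lambda_shift (w n)" by (simp only: w minus_minus)
    also have "\<phi> (- lambda_shift (w n)) = 2 * \<beta> * w n * ev theta3_sq (w n)" by (rule minus[OF w(1)])
    also have "\<dots> = - 2 * \<beta> * pi * (- w n / pi * ev theta3_sq (w n))" by simp
    finally show ?thesis .
  qed
  then have "(\<lambda>n. 2 * \<alpha> * ev theta3_sq (p n)) = (\<lambda>n. - 2 * \<beta> * pi * (- w n / pi * ev theta3_sq (w n)))" by blast
  moreover have "(\<lambda>n. 2 * \<alpha> * ev theta3_sq (p n)) \<longlonglongrightarrow> 2 * \<alpha> * theta3_sq $ 0"
    by (intro tendsto_intros filterlim_compose[OF ev_tendsto_at_bot[OF theta3_sq_radius] p_lim])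
  moreover have "(\<lambda>n. - 2 * \<beta> * pi * (- w n / pi * ev theta3_sq (w n))) \<longlonglongrightarrow> - 2 * \<beta> * pi * 1"
    by (intro tendsto_intros filterlim_compose[OF ev_theta3_sq_asymp w_lim])
  ultimately have "2 * \<alpha> * theta3_sq $ 0 = - 2 * \<beta> * pi * 1" by (metis LIMSEQ_unique)
  then have \<alpha>\<beta>: "\<alpha> = - \<beta> * pi" by (simp add: theta3_sq_nth_0)
  \<comment> \<open>At the symmetric point \<open>s = 0\<close> both formulas give
    \<open>\<phi> 0 = 1\<close>. This locates \<open>u0\<close> at \<open>- pi\<close>, that is, at
    \<open>x = 1\<close>, and fixes the scale.\<close>
  obtain u0 where u0: "u0 < 0" "lambda_shift u0 = 0" using lambda_shift_surj[of 0] by auto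
  have "\<phi> 0 = 1" by (simp add: \<phi>_def ell_even_def ell_odd_def eval_fps_at_0)
  then have *: "2 * \<alpha> * ev theta3_sq u0 = 1" "2 * \<beta> * u0 * ev theta3_sq u0 = 1"
    using plus[OF u0(1)] minus[OF u0(1)] by (simp_all add: u0)
  then have "\<alpha> = \<beta> * u0" using ev_theta3_sq_pos[OF u0(1)] by (metis mult.assoc mult_cancel_left mult_cancel_right less_irrefl zero_neq_numeral)
  then have "\<beta> * u0 = \<beta> * - pi" using \<alpha>\<beta> by simp
  then have "u0 = - pi" by (rule mult_left_cancel[OF \<open>\<beta> \<noteq> 0\<close>, THEN iffD1])
  then have \<alpha>: "2 * \<alpha> = 1 / ev theta3_sq (- pi)" using * ev_theta3_sq_pos[of "- pi"] by (simp add: field_simps)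
  show "ell_even (lambda_shift u) + 2 / ell_ratio * ell_odd (lambda_shift u) = ev theta3_sq u / ev theta3_sq (- pi)"
    using plus[OF assms] unfolding \<phi>_def \<alpha> by simp
  have "2 * \<beta> * pi = - (1 / ev theta3_sq (- pi))" using \<alpha> \<alpha>\<beta> by simp
  then have \<beta>: "2 * \<beta> = - (1 / ev theta3_sq (- pi)) / pi" by (rule eq_divide_imp[OF pi_neq_zero])
  have "ell_even (lambda_shift u) - 2 / ell_ratio * ell_odd (lambda_shift u) = \<phi> (- lambda_shift u)"
    by (simp add: \<phi>_def ell_even_minus ell_odd_minus)
  also have "\<dots> = 2 * \<beta> * u * ev theta3_sq u" by (rule minus[OF assms])
  also have "\<dots> = - u / pi * ev theta3_sq u / ev theta3_sq (- pi)" unfolding \<beta> by simp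
  finally show "ell_even (lambda_shift u) - 2 / ell_ratio * ell_odd (lambda_shift u) = - u / pi * ev theta3_sq u / ev theta3_sq (- pi)" .
qed

section \<open>The Taylor expansion\<close>

lemma theta3_of_real:
  assumes "x > 0"
  shows "theta3 (of_real x) = of_real (ev theta3_series (- pi * x))"
proof -
  define u where "u = - pi * x"
  have u: "u < 0" using assms by (simp add: u_def)
  \<comment> \<open>\<open>S\<close> is the sum over \<open>n\<close> at least 0 and
    \<open>S - 1\<close> the sum over negative \<open>n\<close>, since the term 1 at
    \<open>n = 0\<close> occurs only once.\<close>
  define S where "S = (ev theta3_series u + 1) / 2"
  define g where "g n = exp (u * real_of_int n ^ 2)" for n
  have sums: "(\<lambda>n. g (int n)) sums S" using ev_theta3_series_sums[OF u] by (simp add: g_def S_def)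
  then have "((\<lambda>n. g (int n)) has_sum S) UNIV"
    by (rule sums_nonneg_imp_has_sum) (simp add: g_def)
  then have pos: "(g has_sum S) (range int)"
    by (subst has_sum_reindex) (simp_all add: o_def)
  have "(\<lambda>n. g (int (Suc n))) sums (S - 1)"
    using sums by (subst sums_Suc_iff) (simp add: g_def)
  then have "((\<lambda>n. g (int (Suc n))) has_sum (S - 1)) UNIV"
    by (rule sums_nonneg_imp_has_sum) (simp add: g_def)
  moreover have "g (int (Suc n)) = g (- int (Suc n))" for n
    by (simp only: g_def of_int_minus power2_minus)
  ultimately have "((\<lambda>n. g (- int (Suc n))) has_sum (S - 1)) UNIV" by (simp only:)
  then have neg: "(g has_sum (S - 1)) (range (\<lambda>n. - int (Suc n)))"
    by (subst has_sum_reindex) (simp_all add: o_def inj_def)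
  have "range int \<union> range (\<lambda>n. - int (Suc n)) = UNIV"
  proof (intro equalityI subsetI UNIV_I)
    fix k :: int show "k \<in> range int \<union> range (\<lambda>n. - int (Suc n))"
      by (cases k rule: int_cases) auto
  qed
  moreover have "range int \<inter> range (\<lambda>n. - int (Suc n)) = {}" by auto
  ultimately have "(g has_sum (S + (S - 1))) UNIV"
    using has_sum_Un_disjoint[OF pos neg] by simp
  also have "S + (S - 1) = ev theta3_series u" by (simp add: S_def field_simps)
  finally have "((\<lambda>n. complex_of_real (g n)) has_sum complex_of_real (ev theta3_series u)) UNIV"
    by (simp only: has_sum_of_real_iff)
  moreover have "(\<lambda>n. complex_of_real (g n)) =
      (\<lambda>n. exp (- of_real pi * of_int n ^ 2 * complex_of_real x))"
    by (simp add: g_def u_def exp_of_real[symmetric] mult_ac)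
  ultimately show ?thesis unfolding theta3_def u_def by (simp only: infsumI)
qed

lemma sigma3_of_real:
  assumes "x > 0" "z = (1 - x) / (1 + x)"
  shows "sigma3 (of_real z) = of_real (sqrt ((1 + x) / 2) * ev theta3_series (- pi * x))"
proof -
  \<comment> \<open>Since \<open>1 + z\<close> is positive, the complex principal root is the
    ordinary real one.\<close>
  have z: "1 + z = 2 / (1 + x)" "1 - z = 2 * x / (1 + x)" using assms by (auto simp: field_simps)
  have "(1 - z) / (1 + z) = x" unfolding z using assms(1) by simp
  then have "theta3 ((1 - of_real z) / (1 + of_real z)) = of_real (ev theta3_series (- pi * x))"
    using theta3_of_real[OF assms(1)] by (metis of_real_1 of_real_add of_real_diff of_real_divide)
  moreover have "csqrt (1 + of_real z) = of_real (sqrt (1 + z))"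
    using z assms(1) by (subst of_real_sqrt) auto
  moreover have "1 / sqrt (1 + z) = sqrt ((1 + x) / 2)"
    unfolding z by (simp add: real_sqrt_divide)
  ultimately have "sigma3 (of_real z) = 1 / of_real (sqrt (1 + z)) * of_real (ev theta3_series (- pi * x))"
    unfolding sigma3_def by (simp only:)
  also have "\<dots> = of_real (1 / sqrt (1 + z) * ev theta3_series (- pi * x))" by simp
  finally show ?thesis unfolding \<open>1 / sqrt (1 + z) = sqrt ((1 + x) / 2)\<close> .
qed

text \<open>The expansion of \<open>sigma3\<close> along the curve $z = (2/\rho)\, s\, U(s^2)$, $\rho$ = \<open>ell_ratio\<close>.\<close>

lemma taylor_sigma3_along_curve:
  assumes d: "taylor_sigma3 d" and t: "0 \<le> t" "t < 1/4"
  defines "w \<equiv> t * (eval_fps hyp_odd t / eval_fps hyp_even t) ^ 2 / 2"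
  shows "summable (\<lambda>n. d n / fact (2 * n) * w ^ n)"
    and "(\<Sum>n. d n / fact (2 * n) * w ^ n) ^ 2 = eval_fps hyp_even t"
proof -
  define s where "s = sqrt t"
  have "\<bar>s\<bar> < 1/2" using t square_less_quarter[of s] by (simp add: s_def)
  then obtain u where u: "u < 0" "lambda_shift u = s" by (rule lambda_shift_surj)
  define x where "x = - u / pi"
  define z where "z = (1 - x) / (1 + x)"
  define a1 where "a1 = ev theta3_sq (- pi)"
  have x: "x > 0" "- pi * x = u" using u by (simp_all add: x_def divide_neg_pos)
  have a1: "a1 > 0" using ev_theta3_sq_pos[of "- pi"] by (simp add: a1_def)
  have s2: "s ^ 2 = t" using t by (simp add: s_def)
  have sum: "ell_even s + 2 / ell_ratio * ell_odd s = ev theta3_sq u / a1"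
    using elliptic_combination_eq_theta(1)[OF u(1)] by (simp add: u a1_def)
  have diff: "ell_even s - 2 / ell_ratio * ell_odd s = x * (ev theta3_sq u / a1)"
    using elliptic_combination_eq_theta(2)[OF u(1)] by (simp add: u a1_def x_def)
  have E: "2 * ell_even s = (1 + x) * ev theta3_sq u / a1"
    using sum diff by (simp add: distrib_right add_divide_distrib)
  have O: "4 / ell_ratio * ell_odd s = (1 - x) * ev theta3_sq u / a1"
    using sum diff by (simp add: left_diff_distrib diff_divide_distrib)
  have Epos: "ell_even s > 0"
  proof -
    have "0 < (1 + x) * ev theta3_sq u / a1" using x a1 ev_theta3_sq_pos[OF u(1)] by simp
    then show ?thesis using E by simp
  qed
  have "z = ((1 - x) * ev theta3_sq u / a1) / ((1 + x) * ev theta3_sq u / a1)"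
    using ev_theta3_sq_pos[OF u(1)] a1 by (simp add: z_def)
  then have z: "z = 2 / ell_ratio * (ell_odd s / ell_even s)"
    unfolding E[symmetric] O[symmetric] using Epos by simp
  \<comment> \<open>By \<open>ell_ratio_Phi\<close> the constant \<open>Phi\<close> cancels the
    factor \<open>2 / ell_ratio\<close> in \<open>z\<close> up to \<open>1/2\<close>, leaving an
    expression in \<open>t\<close> alone.\<close>
  have Phi_z: "Phi * z ^ 2 = w"
  proof -
    have "Phi = ell_ratio ^ 2 / 8" using ell_ratio_Phi by simp
    then have "Phi * z ^ 2 = ell_ratio ^ 2 / 8 * (2 / ell_ratio * (ell_odd s / ell_even s)) ^ 2"
      by (simp only: z)
    also have "\<dots> = (ell_odd s / ell_even s) ^ 2 / 2"
      using ell_ratio_pos by (simp add: power_mult_distrib power_divide)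
    finally show ?thesis
      by (simp add: w_def ell_odd_def ell_even_def s2 power_mult_distrib power_divide)
  qed
  have "\<bar>z\<bar> < 1" using x by (simp add: z_def abs_if field_simps)
  then have "norm (complex_of_real z) < 1" by (simp only: norm_of_real)
  then have "(\<lambda>n. theta3 1 * (of_real (d n / fact (2 * n) * Phi ^ n) * of_real z ^ (2 * n))) sums sigma3 (of_real z)"
    using d unfolding taylor_sigma3_def by blast
  moreover have th: "theta3 1 = of_real (ev theta3_series (- pi))" using theta3_of_real[of 1] by simp
  moreover note sigma3_of_real[OF x(1) z_def]
  ultimately have "(\<lambda>n. complex_of_real (ev theta3_series (- pi) * (d n / fact (2 * n) * Phi ^ n * z ^ (2 * n)))) sums
      complex_of_real (sqrt ((1 + x) / 2) * ev theta3_series u)"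
    unfolding x(2) by (simp only: flip: of_real_mult of_real_power)
  then have "(\<lambda>n. ev theta3_series (- pi) * (d n / fact (2 * n) * Phi ^ n * z ^ (2 * n))) sums (sqrt ((1 + x) / 2) * ev theta3_series u)"
    by (simp only: sums_of_real_iff)
  moreover have T1: "ev theta3_series (- pi) > 0" using ev_theta3_series_ge_1[of "- pi"] by simp
  ultimately have "(\<lambda>n. d n / fact (2 * n) * Phi ^ n * z ^ (2 * n)) sums (sqrt ((1 + x) / 2) * ev theta3_series u / ev theta3_series (- pi))"
    using sums_mult[of "\<lambda>n. ev theta3_series (- pi) * (d n / fact (2 * n) * Phi ^ n * z ^ (2 * n))" _ "1 / ev theta3_series (- pi)"] by simp
  moreover have "Phi ^ n * z ^ (2 * n) = w ^ n" for n
    unfolding Phi_z[symmetric] by (simp add: power_mult_distrib power_mult)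
  ultimately have "(\<lambda>n. d n / fact (2 * n) * w ^ n) sums
      (sqrt ((1 + x) / 2) * ev theta3_series u / ev theta3_series (- pi))"
    by (simp add: mult.assoc)
  then have sums: "summable (\<lambda>n. d n / fact (2 * n) * w ^ n)"
    "(\<Sum>n. d n / fact (2 * n) * w ^ n) = sqrt ((1 + x) / 2) * ev theta3_series u / ev theta3_series (- pi)"
    by (simp_all add: sums_iff)
  have "(sqrt ((1 + x) / 2) * ev theta3_series u / ev theta3_series (- pi)) ^ 2 = ((1 + x) * ev theta3_sq u / a1) / 2"
    using x(1) ev_theta3_sq[OF u(1)] ev_theta3_sq[of "- pi"] by (simp add: power_mult_distrib power_divide a1_def)
  also have "\<dots> = eval_fps hyp_even t" unfolding E[symmetric] by (simp add: ell_even_def s2)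
  finally show "(\<Sum>n. d n / fact (2 * n) * w ^ n) ^ 2 = eval_fps hyp_even t" unfolding sums(2) .
  show "summable (\<lambda>n. d n / fact (2 * n) * w ^ n)" by (rule sums(1))
qed

text \<open>Needed to select the correct square root in \<open>V_eq_compose\<close>.\<close>

lemma taylor_sigma3_0:
  assumes "taylor_sigma3 d"
  shows "d 0 = 1"
proof -
  have th: "theta3 1 = of_real (ev theta3_series (- pi))" using theta3_of_real[of 1] by simp
  have "(\<lambda>n. theta3 1 * (of_real (d n / fact (2 * n) * Phi ^ n) * 0 ^ (2 * n))) sums sigma3 0"
    using assms unfolding taylor_sigma3_def by (metis norm_zero zero_less_one)
  moreover have "(\<lambda>n. theta3 1 * (of_real (d n / fact (2 * n) * Phi ^ n) * 0 ^ (2 * n))) =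
      (\<lambda>n. if n = 0 then theta3 1 * of_real (d 0) else 0)"
    by auto
  moreover have "(\<lambda>n. if n = 0 then theta3 1 * of_real (d 0) else 0) sums (theta3 1 * of_real (d 0))"
    using sums_single[of 0 "\<lambda>_. theta3 1 * of_real (d 0)"] by simp
  moreover have "sigma3 0 = theta3 1" by (simp add: sigma3_def)
  ultimately have "theta3 1 * of_real (d 0) = theta3 1" using sums_unique2 by metis
  then show ?thesis using ev_theta3_series_ge_1[of "- pi"] by (simp add: th)
qed

section \<open>Passage to complex expansions and comparison of coefficients\<close>

definition fps_complex :: "real fps \<Rightarrow> complex fps" where
  "fps_complex F = Abs_fps (\<lambda>n. of_real (F $ n))"

lemma fps_complex_nth [simp]: "fps_complex F $ n = of_real (F $ n)"
  by (simp add: fps_complex_def)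

lemma fps_complex_eq_iff: "fps_complex F = fps_complex G \<longleftrightarrow> F = G"
  by (simp add: fps_eq_iff)

lemma fps_complex_mult: "fps_complex (F * G) = fps_complex F * fps_complex G"
  by (simp add: fps_eq_iff fps_mult_nth)

lemma fps_complex_power: "fps_complex (F ^ n) = fps_complex F ^ n"
proof (induction n)
  case 0
  show ?case by (simp add: fps_eq_iff)
qed (simp add: fps_complex_mult)

lemma fps_complex_compose: "fps_complex (F oo G) = fps_complex F oo fps_complex G"
  by (simp add: fps_eq_iff fps_compose_nth flip: fps_complex_power)

lemma fps_complex_X: "fps_complex fps_X = fps_X"
  by (simp add: fps_eq_iff fps_X_def)

lemma fps_complex_const: "fps_complex (fps_const c) = fps_const (of_real c)"
  by (simp add: fps_eq_iff)

lemma fps_conv_radius_complex: "fps_conv_radius (fps_complex F) = fps_conv_radius F"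
  by (simp add: fps_conv_radius_def conv_radius_def)

lemma eval_fps_complex:
  assumes "ereal \<bar>t\<bar> < fps_conv_radius F"
  shows "eval_fps (fps_complex F) (of_real t) = of_real (eval_fps F t)"
proof -
  have "(\<lambda>n. F $ n * t ^ n) sums eval_fps F t" using assms by (intro sums_eval_fps) simp
  then have "(\<lambda>n. complex_of_real (F $ n * t ^ n)) sums of_real (eval_fps F t)"
    by (simp only: sums_of_real_iff)
  then show ?thesis by (simp add: eval_fps_def sums_iff)
qed

text \<open>A function with a nonzero expansion does not vanish in some punctured neighbourhood of
  0, which contains small positive reals.\<close>

lemma has_fps_expansion_zero_on_positive_reals:
  fixes f :: "complex \<Rightarrow> complex"
  assumes "f has_fps_expansion F" "\<epsilon> > 0" and zero: "\<And>t. 0 < t \<Longrightarrow> t < \<epsilon> \<Longrightarrow> f (of_real t) = 0"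
  shows "F = 0"
proof (rule ccontr)
  assume "F \<noteq> 0"
  then have "eventually (\<lambda>x. f x \<noteq> 0) (at 0)"
    using has_laurent_expansion_eventually_nonzero_iff'[OF has_laurent_expansion_fps[OF assms(1)]] by simp
  then obtain \<delta> where \<delta>: "\<delta> > 0" "\<And>x. x \<noteq> 0 \<Longrightarrow> dist x 0 < \<delta> \<Longrightarrow> f x \<noteq> 0"
    unfolding eventually_at by auto
  define t where "t = min \<delta> \<epsilon> / 2"
  have "0 < t" "t < \<epsilon>" "t < \<delta>" using \<delta>(1) assms(2) by (auto simp: t_def)
  then show False using \<delta>(2)[of "of_real t"] zero[of t] by simp
qed

lemma Phi_pos: "Phi > 0"
  using ell_ratio_Phi ell_ratio_pos by (metis zero_less_mult_iff zero_less_numeral zero_less_power not_numeral_less_zero)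

text \<open>By \<open>taylor_sigma3_along_curve\<close>, the square of the composition agrees with
  \<open>hyp_even\<close> at positive reals near 0, hence as a power series, and
  \<open>hyp_even\<close> is the square of \<open>V\<close>.\<close>

lemma V_eq_compose:
  assumes d: "taylor_sigma3 d"
  defines "S \<equiv> Abs_fps (\<lambda>n. d n / fact (2 * n))"
  shows "V = S oo (fps_const (1/2) * (fps_X * U ^ 2))"
proof -
  define W where "W = fps_const (1/2) * (fps_X * U ^ 2)"
  have W0: "W $ 0 = 0" by (simp add: W_def)
  let ?c = fps_complex
  \<comment> \<open>The function with expansion \<open>W\<close>, written through the two series
    whose radius of convergence is known.\<close>
  define g where "g t = (1/2) * (t * (eval_fps (?c hyp_odd) t / eval_fps (?c hyp_even) t) ^ 2)" for t
  have rad: "fps_conv_radius (?c hyp_odd) > 0" "fps_conv_radius (?c hyp_even) > 0"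
    unfolding fps_conv_radius_complex
    by (rule less_le_trans[OF _ hyp_odd_radius] less_le_trans[OF _ hyp_even_radius];
        simp add: zero_ereal_def one_ereal_def numeral_eq_ereal)+
  have "?c hyp_even \<noteq> 0" by (metis fps_complex_nth fps_hypergeo_0 fps_zero_nth of_real_1 zero_neq_one)
  moreover have "?c hyp_odd = ?c U * ?c hyp_even" by (simp only: U_mult_hyp_even flip: fps_complex_mult)
  ultimately have cU: "?c U = ?c hyp_odd / ?c hyp_even" by simp
  have g: "g has_fps_expansion ?c W"
    unfolding g_def W_def fps_complex_mult fps_complex_power fps_complex_X fps_complex_const
      cU of_real_divide of_real_1 of_real_numeral
    by (intro has_fps_expansion_cmult_left has_fps_expansion_mult has_fps_expansion_fps_X
        has_fps_expansion_power has_fps_expansion_divide' eval_fps_has_fps_expansion rad) simp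
  \<comment> \<open>The sample point \<open>z = 1/2\<close> shows that \<open>S\<close> converges at
    \<open>Phi / 4\<close>, hence has positive radius.\<close>
  have "(\<lambda>n. theta3 1 * (of_real (d n / fact (2 * n) * Phi ^ n) * (1/2) ^ (2 * n))) sums sigma3 (1/2)"
    using d unfolding taylor_sigma3_def by (simp add: norm_divide)
  moreover have "of_real (d n / fact (2 * n) * Phi ^ n) * (1/2) ^ (2 * n) =
      ?c S $ n * complex_of_real (Phi / 4) ^ n" for n
    by (simp add: S_def power_mult power_divide)
  ultimately have "summable (\<lambda>n. theta3 1 * (?c S $ n * complex_of_real (Phi / 4) ^ n))"
    by (simp only: sums_iff)
  moreover have "theta3 1 \<noteq> 0"
    using theta3_of_real[of 1] ev_theta3_series_ge_1[of "- pi"] by simp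
  ultimately have "summable (\<lambda>n. ?c S $ n * complex_of_real (Phi / 4) ^ n)"
    by (metis summable_mult_D)
  then have "fps_conv_radius (?c S) \<ge> norm (complex_of_real (Phi / 4))"
    unfolding fps_conv_radius_def by (rule conv_radius_geI)
  moreover have "ereal (norm (complex_of_real (Phi / 4))) > 0"
    using Phi_pos by (simp add: zero_ereal_def)
  ultimately have radS: "fps_conv_radius (?c S) > 0" by (rule less_le_trans[rotated])
  define f where "f t = (eval_fps (?c S) \<circ> g) t ^ 2 - eval_fps (?c hyp_even) t" for t
  have f: "f has_fps_expansion (?c S oo ?c W) ^ 2 - ?c hyp_even"
    unfolding f_def using radS rad g W0
    by (intro fps_expansion_intros eval_fps_has_fps_expansion) auto
  have "(?c S oo ?c W) ^ 2 - ?c hyp_even = 0"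
  proof (rule has_fps_expansion_zero_on_positive_reals[OF f])
    fix t :: real assume t: "0 < t" "t < 1/4"
    define w where "w = t * (eval_fps hyp_odd t / eval_fps hyp_even t) ^ 2 / 2"
    note along = taylor_sigma3_along_curve[OF d less_imp_le[OF t(1)] t(2), folded w_def]
    have "ereal \<bar>t\<bar> < 1/4" using t by (simp add: one_ereal_def numeral_eq_ereal)
    then have rt: "ereal \<bar>t\<bar> < fps_conv_radius hyp_odd" "ereal \<bar>t\<bar> < fps_conv_radius hyp_even"
      using hyp_even_radius hyp_odd_radius by (auto intro: less_le_trans)
    have gt: "g (of_real t) = of_real w" by (simp add: g_def w_def eval_fps_complex rt)
    have "(\<lambda>n. complex_of_real (d n / fact (2 * n) * w ^ n)) sums of_real (\<Sum>n. d n / fact (2 * n) * w ^ n)"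
      unfolding sums_of_real_iff using along(1) by (rule summable_sums)
    then have "eval_fps (?c S) (of_real w) = of_real (\<Sum>n. d n / fact (2 * n) * w ^ n)"
      by (simp add: eval_fps_def S_def sums_iff)
    then have "(eval_fps (?c S) \<circ> g) (of_real t) ^ 2 = of_real (eval_fps hyp_even t)"
      unfolding o_def gt along(2)[symmetric] by simp
    then show "f (of_real t) = 0" unfolding f_def eval_fps_complex[OF rt(2)] by simp
  qed simp
  then have "?c ((S oo W) ^ 2) = ?c hyp_even" by (simp add: fps_complex_power fps_complex_compose)
  then have "(S oo W) ^ 2 = V ^ 2" by (simp add: fps_complex_eq_iff V_square)
  \<comment> \<open>Equal squares leave two candidates; the constant term 1 excludes
    \<open>- V\<close>.\<close>
  moreover have "(S oo W) $ 0 = 1" using taylor_sigma3_0[OF d] by (simp add: S_def)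
  then have "S oo W \<noteq> - V" using V_nth_0 by (metis fps_neg_nth one_neq_neg_one)
  ultimately show ?thesis unfolding W_def[symmetric] by (auto simp: power2_eq_iff)
qed

lemma U_nth_0: "U $ 0 = 1"
  using arg_cong[OF U_mult_hyp_even, of "\<lambda>F. F $ 0"] by simp

text \<open>The \<open>k\<close>-th power of the inner series is
  \<open>t ^ k * U ^ (2 * k) / 2 ^ k\<close>. Scaling the coefficient of \<open>t ^ n\<close> by
  \<open>2 ^ n * fact (2 * n)\<close> produces exactly \<open>r n k\<close>.\<close>

lemma v_eq_sum_r:
  assumes "taylor_sigma3 d"
  shows "v n = (\<Sum>k\<le>n. r n k * d k)"
proof -
  have "V $ n = (\<Sum>k\<le>n. d k / fact (2 * k) * (1/2) ^ k * (U ^ (2 * k)) $ (n - k))"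
    unfolding V_eq_compose[OF assms] fps_compose_nth atLeast0AtMost
    by (intro sum.cong refl)
       (simp add: power_mult_distrib fps_const_power fps_X_power_mult_nth flip: power_mult)
  then have "v n = (\<Sum>k\<le>n. 2 ^ n * fact (2 * n) * (d k / fact (2 * k) * (1/2) ^ k * (U ^ (2 * k)) $ (n - k)))"
    by (simp only: v_def sum_distrib_left)
  also have "\<dots> = (\<Sum>k\<le>n. r n k * d k)"
  proof (intro sum.cong refl)
    fix k assume "k \<in> {..n}"
    then have "(2::real) ^ n * (1/2) ^ k = 2 ^ (n - k)" by (simp add: power_diff power_divide)
    then show "2 ^ n * fact (2 * n) * (d k / fact (2 * k) * (1/2) ^ k * (U ^ (2 * k)) $ (n - k)) = r n k * d k"
      by (simp add: r_def)
  qed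
  finally show ?thesis .
qed

theorem theorem7:
  shows "(\<forall>n k. 1 \<le> k \<and> k \<le> n \<longrightarrow> r n k \<in> \<int>) \<and>
         (\<forall>d. taylor_sigma3 d \<longrightarrow>
           (\<forall>n\<ge>1. d n = v n - (\<Sum>k=1..n-1. r n k * d k)))"
proof (intro conjI allI impI)
  show "r n k \<in> \<int>" if "1 \<le> k \<and> k \<le> n" for n k using that by (simp add: r_Ints)
  fix d n assume d: "taylor_sigma3 d" and n: "(1::nat) \<le> n"
  \<comment> \<open>The two extreme terms are split off: \<open>r n 0 = 0\<close> because
    \<open>U ^ 0 = 1\<close> has no coefficient at \<open>n > 0\<close>, and
    \<open>r n n = 1\<close> because \<open>U $ 0 = 1\<close>.\<close>
  have "{..n} = insert 0 (insert n {1..n-1})" using n by auto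
  then have "v n = r n 0 * d 0 + (r n n * d n + (\<Sum>k=1..n-1. r n k * d k))"
    unfolding v_eq_sum_r[OF d] using n by simp
  moreover have "r n 0 = 0" using n by (simp add: r_def)
  moreover have "r n n = 1" by (simp add: r_def U_nth_0 fps_power_zeroth)
  ultimately show "d n = v n - (\<Sum>k=1..n-1. r n k * d k)" by simp
qed

end
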